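(* Let $k>1$ be an integer, let $x>0$ be real, and let $M_0\ge 6$ be an integer. Let $M=M(x,k)$ be the nonnegative integer satisfying $$2^k+3^k+\cdots+p_M^k\le x<2^k+3^k+\cdots+p_M^k+p_{M+1}^k .$$ If $M\ge M_0$, then $$ s_k(x)\le c_k\cdot \frac{x^{2/(k+1)}}{(\log x)^{2k/(k+1)}}\cdot U(M_0,k).$$
   Context: $p_n$ denotes the $n$th prime, with $p_1=2$. For an integer $k\ge1$, a positive integer $n$ is called $k$-gleeful if it can be written as a sum $p_i^k+p_{i+1}^k+\cdots+p_j^k$ of $k$th powers of consecutive primes ($1\le i\le j$); $f_k(n)$ denotes the number of such representations of $n$ (i.e. the number of pairs $(i,j)$), and $s_k(x)=\sum_{1\le n\le x} f_k(n)$ is the total number of $k$-gleeful representations of integers up to $x$. Define $c_k=\frac{k^2}{k-1}(k+1)^{(k-1)/k}$, and for $y\ge 6$: $A(y)=\frac{\log(y/2)}{\log y}$; $B(y,k)=\frac{\log(y+1)}{\log y}+\frac{\log\log\left((y+1)^2\right)}{\log y}\cdot\frac{k}{k+1}$; $C(y,k)=\left(\frac{y}{y-1}\right)^{1/(k+1)}B(y,k)^{k/(k+1)}$; $E(y,k)=1+\frac{1}{(k+1)A(y)-1}$; $F(y,k)=\left(\frac{y+1}{y}\right)^{(k-1)/k}\cdot 4^{(k-1)/(k(k+1))}\cdot C(y,k)^{(k-1)/k}\cdot E(y,k)$; $U(y,k)=1.25506\cdot F(y,k)$. *)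

theory Defs
  imports Complex_Main "HOL-Library.Infinite_Set" "HOL-Computational_Algebra.Primes"
begin

text \<open>p n is the n-th prime, with p 1 = 2 (1-indexed; p 0 is a junk value, never used).\<close>
definition p :: "nat \<Rightarrow> nat" where
  "p n = enumerate {q::nat. prime q} (n - 1)"

definition f :: "nat \<Rightarrow> nat \<Rightarrow> nat" where
  "f k n = card {(i, j). 1 \<le> i \<and> i \<le> j \<and> (\<Sum>t=i..j. p t ^ k) = n}"

definition s :: "nat \<Rightarrow> real \<Rightarrow> nat" where
  "s k x = (\<Sum>n\<in>{n::nat. 1 \<le> n \<and> real n \<le> x}. f k n)"

definition c :: "nat \<Rightarrow> real" where
  "c k = (real k)^2 / (real k - 1) * (real k + 1) powr ((real k - 1) / real k)"

definition A :: "real \<Rightarrow> real" where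
  "A y = ln (y / 2) / ln y"

definition B :: "real \<Rightarrow> nat \<Rightarrow> real" where
  "B y k = ln (y + 1) / ln y + ln (ln ((y + 1)^2)) / ln y * (real k / (real k + 1))"

definition C :: "real \<Rightarrow> nat \<Rightarrow> real" where
  "C y k = (y / (y - 1)) powr (1 / (real k + 1)) * B y k powr (real k / (real k + 1))"

definition E :: "real \<Rightarrow> nat \<Rightarrow> real" where
  "E y k = 1 + 1 / ((real k + 1) * A y - 1)"

definition F :: "real \<Rightarrow> nat \<Rightarrow> real" where
  "F y k = ((y + 1) / y) powr ((real k - 1) / real k)
           * 4 powr ((real k - 1) / (real k * (real k + 1)))
           * C y k powr ((real k - 1) / real k) * E y k"

definition U :: "real \<Rightarrow> nat \<Rightarrow> real" where
  "U y k = 1.25506 * F y k"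

end

theory Submission
  imports Defs "HOL-Library.Code_Binary_Nat" "HOL-Analysis.Harmonic_Numbers" "HOL-Analysis.Convex"
begin

text \<open>
  Two ideas replace the explicit estimates of Rosser and Schoenfeld on primes.

  First, Chebyshev's quotient \<open>(30N)! N! / ((15N)! (10N)! (6N)!)\<close> together with the list of the primes below
  1024 yields \<open>prime_pi n \<le> 1.38 n / ln n\<close>.

  Second, let \<open>P m\<close> be the number of \<open>t\<close> with \<open>m * p t ^ k \<le> x\<close>. A representation of length \<open>m \<le> q\<close> starts
  at one of \<open>P m\<close> indices, and one of length above \<open>q\<close> is determined by two indices counted by \<open>P q\<close>, so
  \<open>s k x \<le> (\<Sum>m\<le>q. P m) + (P q choose 2)\<close> for every \<open>q\<close>. If \<open>q\<close> is chosen such that \<open>P q / q\<close> is about \<open>k\<close>, the gain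
  over counting all lengths by their starting index absorbs the loss from 1.25506 to 1.38. From \<open>U\<close> one
  only needs \<open>C \<ge> 1\<close> and \<open>E \<ge> 1 + 1 / k\<close>.
\<close>

section \<open>Chebyshev's bound for the product of primes\<close>

text \<open>Let \<open>b * m powr (-1/k)\<close> be the bound on \<open>P m\<close> and
  \<open>r = b / q powr (1 + 1/k)\<close>, so that \<open>P q <= r * q\<close>. The count is then at
  most \<open>q^2 * (k/(k-1) * r + r^2/2)\<close>. Over real \<open>q\<close> this is least at
  \<open>r = k\<close>, which is where the ratio \<open>k\<close> comes from. With \<open>U\<close>
  weakened, the target is \<open>1.25506 / 1.38^2\<close>, about 0.659, times
  \<open>q^2 * k/(k-1) * r^2 * exp (target_exp k r)\<close>. So \<open>x\<close> and
  \<open>q\<close> cancel, and \<open>1/r + (k-1)/(2*k) <= 0.659 * exp (target_exp k r)\<close>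
  remains. For \<open>r\<close> near \<open>k\<close> and \<open>k\<close> large it reads 1/2 <
  0.659: the 1/2 of the binomial coefficient pays for the square of 1.38. The obstacle is that
  \<open>q\<close> is an integer, so \<open>r\<close> only falls into a window around
  \<open>k\<close>: the least \<open>q\<close> with \<open>r <= 1.7 * k\<close> satisfies
  \<open>r >= 1.7 * k / 2 powr (1 + 1/k)\<close> if \<open>q >= 2\<close>. If \<open>q = 1\<close>
  this lower bound is missing; then \<open>r >= 6\<close>, because \<open>M >= 6\<close> provides
  six starting indices, and the count \<open>P 1 * (P 1 + 1) / 2\<close> is compared
  directly.\<close>

lemma div_Suc_eq_div_plus_dvd:
  fixes q n :: nat
  assumes "q > 0"
  shows "Suc n div q = n div q + (if q dvd Suc n then 1 else 0)"
  using assms by (simp add: div_Suc dvd_eq_mod_eq_0)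

lemma multiplicity_eq_sum:
  fixes r n :: nat
  assumes "prime r" "n > 0" "n \<le> K"
  shows "multiplicity r n = (\<Sum>i=1..K. if r ^ i dvd n then 1 else 0)"
proof -
  have r2: "r \<ge> 2" using assms(1) prime_ge_2_nat by blast
  have iff: "r ^ i dvd n \<longleftrightarrow> i \<le> multiplicity r n" for i
    using assms r2 by (intro power_dvd_iff_le_multiplicity) (auto simp: not_prime_unit)
  have "multiplicity r n \<le> K"
  proof -
    have "r ^ multiplicity r n \<le> n"
      using assms(2) multiplicity_dvd dvd_imp_le by blast
    moreover have "multiplicity r n < r ^ multiplicity r n"
      using r2 by (simp add: power_gt_expt)
    ultimately show ?thesis using assms(3) by linarith
  qed
  then have "{i \<in> {1..K}. i \<le> multiplicity r n} = {1..multiplicity r n}" by auto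
  then show ?thesis by (simp add: iff sum.If_cases Int_def conj_commute)
qed

lemma multiplicity_fact:
  fixes r n :: nat
  assumes "prime r" "n \<le> K"
  shows "multiplicity r (fact n) = (\<Sum>i=1..K. n div r ^ i)"
  using assms(2)
proof (induction n)
  case (Suc n)
  have "r > 0" using assms(1) prime_gt_0_nat by blast
  have "multiplicity r (fact (Suc n) :: nat) = multiplicity r (Suc n) + multiplicity r (fact n :: nat)"
    using assms(1) by (simp add: prime_elem_multiplicity_mult_distrib del: mult_Suc of_nat_Suc)
  also have "\<dots> = (\<Sum>i=1..K. Suc n div r ^ i)"
    using Suc assms(1) \<open>r > 0\<close>
    by (simp add: multiplicity_eq_sum div_Suc_eq_div_plus_dvd sum.distrib del: of_nat_Suc)
  finally show ?case .
qed simp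

text \<open>With \<open>w = 30 * N div q\<close>, nested floors reduce the claim to
  \<open>w + w div 30 - w div 2 - w div 3 - w div 5\<close>. This is periodic modulo 30 because 1 +
  1/30 = 1/2 + 1/3 + 1/5. It is never negative, and it equals 1 for \<open>w\<close> from 1 to 5,
  which covers \<open>5 * N < q\<close> and \<open>q <= 30 * N\<close>.\<close>

lemma chebyshev_floor:
  fixes N q :: nat
  assumes "q > 0"
  shows "15 * N div q + 10 * N div q + 6 * N div q
    + (if 5 * N < q \<and> q \<le> 30 * N then 1 else 0) \<le> 30 * N div q + N div q"
proof -
  define w where "w = 30 * N div q"
  have d: "j * N div q = w div e" if "j * e = 30" "e > 0" for j e
  proof -
    have "30 * N = j * N * e" by (simp flip: that(1))
    then have "w div e = (j * N * e) div (q * e)"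
      by (simp only: w_def div_mult2_eq)
    then show ?thesis using that by simp
  qed
  have d2: "15 * N div q = w div 2" and d3: "10 * N div q = w div 3"
    and d5: "6 * N div q = w div 5" and d30: "N div q = w div 30"
    using d[of 15 2] d[of 10 3] d[of 6 5] d[of 1 30] by simp_all
  have w1: "w \<ge> 1" if "q \<le> 30 * N"
    using that assms by (simp add: w_def Suc_le_eq div_greater_zero_iff)
  have w6: "w < 6" if "5 * N < q"
    using that assms unfolding w_def by (intro less_mult_imp_div_less) auto
  define t u where "t = w div 30" and "u = w mod 30"
  have w: "w = 30 * t + u" and u: "u < 30" by (simp_all add: t_def u_def)
  have a: "w div 2 = 15 * t + u div 2" "w div 3 = 10 * t + u div 3" "w div 5 = 6 * t + u div 5"
    "w div 30 = t"
    using u by (simp_all add: w div_add1_eq)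
  have "\<forall>u\<in>set [0..<30]. u div 2 + u div 3 + u div 5 \<le> (u::nat)" by code_simp
  then have b: "u div 2 + u div 3 + u div 5 \<le> u" using u by simp
  have "\<forall>u\<in>set [1..<6]. u div 2 + u div 3 + u div 5 + 1 \<le> (u::nat)" by code_simp
  then have c: "u div 2 + u div 3 + u div 5 + 1 \<le> u" if "1 \<le> u" "u < 6" using that by simp
  show ?thesis
  proof (cases "5 * N < q \<and> q \<le> 30 * N")
    case True
    then have "t = 0" "1 \<le> u" "u < 6" using w1 w6 by (auto simp: t_def u_def)
    then show ?thesis using True c unfolding d2 d3 d5 d30 w_def[symmetric] a by (simp add: w)
  next
    case False
    then show ?thesis using b unfolding d2 d3 d5 d30 w_def[symmetric] a by (auto simp: w)
  qed
qed

text \<open>Legendre's formula turns divisibility into \<open>chebyshev_floor\<close> at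
  \<open>q = r ^ i\<close>, summed over \<open>i\<close>; a prime of the product is paid for by the
  term \<open>i = 1\<close>.\<close>

lemma prod_primes_mult_fact_dvd:
  "\<Prod>{r. prime r \<and> 5 * N < r \<and> r \<le> 30 * N} * (fact (15 * N) * fact (10 * N) * fact (6 * N))
    dvd (fact (30 * N) * fact N :: nat)"
proof -
  define S where "S = {r::nat. prime r \<and> 5 * N < r \<and> r \<le> 30 * N}"
  have finS: "finite S" unfolding S_def by (rule finite_subset[of _ "{..30 * N}"]) auto
  have nz: "\<Prod>S \<noteq> 0" using finS by (auto simp: S_def prod_zero_iff)
  have "multiplicity r (\<Prod>S * (fact (15 * N) * fact (10 * N) * fact (6 * N)))
      \<le> multiplicity r (fact (30 * N) * fact N)" if r: "prime r" for r :: nat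
  proof -
    have "multiplicity r (\<Prod>S) = (\<Sum>x\<in>S. multiplicity r x)"
      using finS r by (intro prime_elem_multiplicity_prod_distrib) (auto simp: S_def)
    also have "\<dots> = (\<Sum>x\<in>S. if x = r then 1 else 0)"
      using r by (intro sum.cong refl) (auto simp: S_def prime_multiplicity_other)
    also have "\<dots> = (if r \<in> S then 1 else 0)" using finS by simp
    also have "\<dots> \<le> (\<Sum>i=1..30*N. if 5 * N < r ^ i \<and> r ^ i \<le> 30 * N then 1 else 0)"
    proof (cases "r \<in> S")
      case True
      then have "1 \<in> {1..30*N}" using prime_ge_1_nat[OF r] by (auto simp: S_def)
      then show ?thesis using True
        by (intro order_trans[OF _ member_le_sum[of 1]]) (auto simp: S_def)
    qed simp
    finally have m: "multiplicity r (\<Prod>S) \<le> \<dots>" .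
    have "multiplicity r (\<Prod>S * (fact (15 * N) * fact (10 * N) * fact (6 * N))) =
      multiplicity r (\<Prod>S) + (multiplicity r (fact (15 * N) :: nat) + multiplicity r (fact (10 * N) :: nat)
      + multiplicity r (fact (6 * N) :: nat))"
      using nz r by (simp add: prime_elem_multiplicity_mult_distrib)
    also have "\<dots> \<le> (\<Sum>i=1..30*N. 15 * N div r ^ i + 10 * N div r ^ i + 6 * N div r ^ i
        + (if 5 * N < r ^ i \<and> r ^ i \<le> 30 * N then 1 else 0))"
      using m by (simp add: multiplicity_fact[OF r, of _ "30 * N"] sum.distrib)
    also have "\<dots> \<le> (\<Sum>i=1..30*N. 30 * N div r ^ i + N div r ^ i)"
      using prime_gt_0_nat[OF r] by (intro sum_mono chebyshev_floor) auto
    also have "\<dots> = multiplicity r (fact (30 * N) * fact N)"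
      using r by (simp add: prime_elem_multiplicity_mult_distrib multiplicity_fact[OF r, of _ "30 * N"] sum.distrib)
    finally show ?thesis .
  qed
  then show ?thesis using nz unfolding S_def[symmetric] by (intro multiplicity_le_imp_dvd) auto
qed

section \<open>Growth of Chebyshev's quotient\<close>

lemma fact_add_eq_prod: "fact (n + m) = fact n * (\<Prod>i=1..m. n + i :: nat)"
  by (induction m) (auto simp: algebra_simps)

text \<open>Left factors whose \<open>i\<close> has a common divisor with 30 cancel against right
  factors up to powers of 2, 3 and 5. The eight with \<open>i\<close> coprime to 30, together with
  \<open>6 * (N + 1)\<close>, are matched in \<open>le\<close> with the nine right factors left
  over. The constant is \<open>30^30 / (15^15 * 10^10 * 6^6)\<close>, the limit of the ratio of the
  two products.\<close>

lemma fact_ratio_step: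
  fixes N :: nat
  shows "(\<Prod>i=1..30. 30 * N + i) * (N + 1) \<le>
    2 ^ 14 * 3 ^ 9 * 5 ^ 5 * ((\<Prod>i=1..15. 15 * N + i) * (\<Prod>i=1..10. 10 * N + i) * (\<Prod>i=1..6. 6 * N + i))"
proof -
  have p30: "prod g {1..30} = g 1 * g 2 * g 3 * g 4 * g 5 * g 6 * g 7 * g 8 * g 9 * g 10 * g 11 * g 12 * g 13 * g 14 * g 15 * g 16 * g 17 * g 18 * g 19 * g 20 * g 21 * g 22 * g 23 * g 24 * g 25 * g 26 * g 27 * g 28 * g 29 * g 30" for g :: "nat \<Rightarrow> nat"
    by (simp add: numeral_eq_Suc)
  have p15: "prod g {1..15} = g 1 * g 2 * g 3 * g 4 * g 5 * g 6 * g 7 * g 8 * g 9 * g 10 * g 11 * g 12 * g 13 * g 14 * g 15" for g :: "nat \<Rightarrow> nat"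
    by (simp add: numeral_eq_Suc)
  have p10: "prod g {1..10} = g 1 * g 2 * g 3 * g 4 * g 5 * g 6 * g 7 * g 8 * g 9 * g 10" for g :: "nat \<Rightarrow> nat"
    by (simp add: numeral_eq_Suc)
  have p6: "prod g {1..6} = g 1 * g 2 * g 3 * g 4 * g 5 * g 6" for g :: "nat \<Rightarrow> nat"
    by (simp add: numeral_eq_Suc)
  define h where "h i = 15 * N + i" for i
  define u where "u i = 10 * N + i" for i
  define v where "v i = 6 * N + i" for i
  define g where "g i = 30 * N + i" for i
  have ev: "g 2 = 2 * h 1" "g 4 = 2 * h 2" "g 6 = 2 * h 3" "g 8 = 2 * h 4" "g 10 = 2 * h 5" "g 12 = 2 * h 6"
    "g 14 = 2 * h 7" "g 16 = 2 * h 8" "g 18 = 2 * h 9" "g 20 = 2 * h 10" "g 22 = 2 * h 11" "g 24 = 2 * h 12"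
    "g 26 = 2 * h 13" "g 28 = 2 * h 14" "g 30 = 2 * h 15"
    "g 3 = 3 * u 1" "g 9 = 3 * u 3" "g 15 = 3 * u 5" "g 21 = 3 * u 7" "g 27 = 3 * u 9"
    "g 5 = 5 * v 1" "g 25 = 5 * v 5"
    by (simp_all add: g_def h_def u_def v_def)
  have le: "g 1 \<le> 3 * u 2" "g 7 \<le> 5 * v 2" "g 11 \<le> 3 * u 4" "g 13 \<le> 5 * v 3" "g 17 \<le> 3 * u 6" "g 19 \<le> 5 * v 4"
    "g 23 \<le> 3 * u 8" "g 29 \<le> 3 * u 10" "6 * (N + 1) \<le> v 6"
    by (simp_all add: g_def u_def v_def)
  have le9: "g 1 * g 7 * g 11 * g 13 * g 17 * g 19 * g 23 * g 29 * (6 * (N + 1)) \<le>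
    (3 * u 2) * (5 * v 2) * (3 * u 4) * (5 * v 3) * (3 * u 6) * (5 * v 4) * (3 * u 8) * (3 * u 10) * v 6"
    by (intro mult_mono le) auto
  define R where "R = g 1 * g 7 * g 11 * g 13 * g 17 * g 19 * g 23 * g 29"
  define W where "W = prod h {1..15} * (u 1 * u 3 * u 5 * u 7 * u 9) * (v 1 * v 5)"
  define V where "V = (u 2 * u 4 * u 6 * u 8 * u 10) * (v 2 * v 3 * v 4 * v 6)"
  have e1: "prod g {1..30} = (g 2 * g 4 * g 6 * g 8 * g 10 * g 12 * g 14 * g 16 * g 18 * g 20 * g 22 * g 24 * g 26 * g 28 * g 30)
     * (g 3 * g 9 * g 15 * g 21 * g 27) * (g 5 * g 25) * R"
    unfolding p30 R_def by (simp only: mult_ac)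
  have e2: "g 2 * g 4 * g 6 * g 8 * g 10 * g 12 * g 14 * g 16 * g 18 * g 20 * g 22 * g 24 * g 26 * g 28 * g 30 =
     2 ^ 15 * prod h {1..15}"
    unfolding ev p15 by simp
  have e3: "g 3 * g 9 * g 15 * g 21 * g 27 = 3 ^ 5 * (u 1 * u 3 * u 5 * u 7 * u 9)"
    unfolding ev by simp
  have e4: "g 5 * g 25 = 5 ^ 2 * (v 1 * v 5)"
    unfolding ev by simp
  have "6 * (prod g {1..30} * (N + 1)) = 2 ^ 15 * 3 ^ 5 * 5 ^ 2 * W * (R * (6 * (N + 1)))"
    unfolding e1 e2 e3 e4 W_def by (simp only: mult_ac)
  also have "R * (6 * (N + 1)) \<le> 3 ^ 5 * 5 ^ 3 * V"
  proof -
    have "(3 * u 2) * (5 * v 2) * (3 * u 4) * (5 * v 3) * (3 * u 6) * (5 * v 4) * (3 * u 8) * (3 * u 10) * v 6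
      = (3 * 3 * 3 * 3 * 3) * (5 * 5 * 5) * V"
      unfolding V_def by (simp only: mult_ac)
    then show ?thesis using le9 unfolding R_def by simp
  qed
  also have "2 ^ 15 * 3 ^ 5 * 5 ^ 2 * W * (3 ^ 5 * 5 ^ 3 * V) = 6 * (2 ^ 14 * 3 ^ 9 * 5 ^ 5 * (W * V))"
    by simp
  also have "W * V = prod h {1..15} * prod u {1..10} * prod v {1..6}"
    unfolding W_def V_def p10 p6 by (simp only: mult_ac)
  finally have "prod g {1..30} * (N + 1) \<le> 2 ^ 14 * 3 ^ 9 * 5 ^ 5 * (prod h {1..15} * prod u {1..10} * prod v {1..6})"
    by (simp only: nat_mult_le_cancel_disj) simp
  then show ?thesis unfolding g_def h_def u_def v_def .
qed

lemma fact_ratio_le: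
  fixes N :: nat
  shows "fact (30 * N) * fact N \<le>
    (2 ^ 14 * 3 ^ 9 * 5 ^ 5) ^ N * (fact (15 * N) * fact (10 * N) * fact (6 * N) :: nat)"
proof (induction N)
  case (Suc N)
  define K where "K = (2 ^ 14 * 3 ^ 9 * 5 ^ 5 :: nat)"
  define P where "P m = (\<Prod>i=1..m. m * N + i)" for m
  have f: "fact (m * Suc N) = fact (m * N) * P m" for m
    unfolding P_def mult_Suc_right by (subst add.commute, rule fact_add_eq_prod)
  have f1: "fact (Suc N) = fact N * (N + 1)" by simp
  have step: "P 30 * (N + 1) \<le> K * (P 15 * P 10 * P 6)"
    unfolding P_def K_def by (rule fact_ratio_step)
  have IH: "fact (30 * N) * fact N \<le> K ^ N * (fact (15 * N) * fact (10 * N) * fact (6 * N))"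
    using Suc.IH unfolding K_def .
  have "fact (30 * Suc N) * fact (Suc N) = (fact (30 * N) * fact N) * (P 30 * (N + 1))"
    unfolding f f1 by (simp only: mult_ac)
  also have "\<dots> \<le> (K ^ N * (fact (15 * N) * fact (10 * N) * fact (6 * N))) * (K * (P 15 * P 10 * P 6))"
    by (rule mult_mono[OF IH step]) simp_all
  also have "\<dots> = K ^ Suc N * (fact (15 * Suc N) * fact (10 * Suc N) * fact (6 * Suc N))"
    unfolding f power_Suc by (simp only: mult_ac)
  finally show ?case unfolding K_def .
qed simp

section \<open>The functions \<open>prime_pi\<close> and \<open>theta\<close>\<close>

definition prime_pi :: "nat \<Rightarrow> nat" where
  "prime_pi n = card {r. prime r \<and> r \<le> n}"

definition theta :: "nat \<Rightarrow> real" where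
  "theta n = (\<Sum>r | prime r \<and> r \<le> n. ln (real r))"

lemma finite_primes_le [simp]: "finite {r::nat. prime r \<and> r \<le> n}"
  by (rule finite_subset[of _ "{..n}"]) auto

lemma primes_le_Suc:
  "{r::nat. prime r \<and> r \<le> Suc n} = (if prime (Suc n) then insert (Suc n) {r. prime r \<and> r \<le> n} else {r. prime r \<and> r \<le> n})"
  by (auto simp: le_Suc_eq)

lemma prime_pi_Suc: "prime_pi (Suc n) = prime_pi n + (if prime (Suc n) then 1 else 0)"
  unfolding prime_pi_def primes_le_Suc by auto

lemma theta_Suc: "theta (Suc n) = theta n + (if prime (Suc n) then ln (real (Suc n)) else 0)"
  unfolding theta_def primes_le_Suc by auto

lemma theta_mono: "m \<le> n \<Longrightarrow> theta m \<le> theta n"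
  unfolding theta_def by (rule sum_mono2) (auto simp: prime_ge_1_nat)

lemma ln_2_bounds: "ln 2 \<ge> (6931/10000::real)" "ln 2 \<le> (69315/100000::real)"
  using ln_approx_bounds[of 2 5] by (simp_all add: eval_nat_numeral)

lemma ln_3_bounds: "ln 3 \<ge> (10986/10000::real)" "ln 3 \<le> (109862/100000::real)"
  using ln_approx_bounds[of 3 9] by (simp_all add: eval_nat_numeral)

lemma ln_5_bounds: "ln 5 \<ge> (16094/10000::real)" "ln 5 \<le> (160945/100000::real)"
  using ln_approx_bounds[of 5 14] by (simp_all add: eval_nat_numeral)

lemma ln_chebyshev_const: "ln (real (2 ^ 14 * 3 ^ 9 * 5 ^ 5)) \<le> 691/25"
proof -
  have "ln (real (2 ^ 14 * 3 ^ 9 * 5 ^ 5)) = ln (2 ^ 14) + ln (3 ^ 9) + ln ((5::real) ^ 5)"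
    by (simp only: of_nat_mult of_nat_power of_nat_numeral ln_mult_pos zero_less_power mult_pos_pos zero_less_numeral)
  also have "\<dots> = 14 * ln 2 + 9 * ln 3 + 5 * ln 5"
    by (simp only: ln_realpow zero_less_numeral of_nat_numeral)
  finally show ?thesis using ln_2_bounds ln_3_bounds ln_5_bounds by linarith
qed

text \<open>The product of the primes above \<open>5 * N\<close> and up to \<open>30 * N\<close> is
  at most Chebyshev's quotient, hence at most the \<open>N\<close>-th power of the constant whose
  logarithm is below 691/25.\<close>

lemma theta_30: "theta (30 * N) \<le> theta (5 * N) + 691 / 25 * real N"
proof -
  define S where "S = {r. prime r \<and> 5 * N < r \<and> r \<le> 30 * N}"
  define K :: nat where "K = 2 ^ 14 * 3 ^ 9 * 5 ^ 5"
  define D where "D = (fact (15 * N) * fact (10 * N) * fact (6 * N) :: nat)"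
  have finS: "finite S" unfolding S_def by (rule finite_subset[of _ "{..30 * N}"]) auto
  have eq: "{r. prime r \<and> r \<le> 30 * N} = {r. prime r \<and> r \<le> 5 * N} \<union> S" by (auto simp: S_def)
  have "\<Prod>S * D \<le> fact (30 * N) * fact N"
    using prod_primes_mult_fact_dvd[of N] unfolding S_def D_def by (intro dvd_imp_le) auto
  also have "\<dots> \<le> K ^ N * D"
    unfolding D_def K_def by (rule fact_ratio_le)
  finally have "\<Prod>S \<le> K ^ N" unfolding D_def by simp
  moreover have "\<Prod>S > 0" using finS by (auto simp: S_def prime_gt_0_nat intro!: prod_pos)
  ultimately have "ln (real (\<Prod>S)) \<le> ln (real (K ^ N))"
    by (intro ln_mono) (simp_all only: of_nat_le_iff of_nat_0_less_iff)
  also have "\<dots> = real N * ln (real K)"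
    unfolding of_nat_power by (rule ln_realpow)
  also have "\<dots> \<le> real N * (691 / 25)"
    using ln_chebyshev_const unfolding K_def by (rule mult_left_mono) simp
  finally have "ln (real (\<Prod>S)) \<le> real N * (691 / 25)" .
  moreover have "theta (30 * N) = theta (5 * N) + (\<Sum>r\<in>S. ln (real r))"
    unfolding theta_def eq using finS by (intro sum.union_disjoint) (auto simp: S_def)
  moreover have "(\<Sum>r\<in>S. ln (real r)) = ln (real (\<Prod>S))"
    using finS by (subst of_nat_prod, subst ln_prod) (auto simp: S_def prime_gt_0_nat)
  ultimately show ?thesis by simp
qed

section \<open>Primes below 1024\<close>

definition primes_1024 :: "nat list" where
  "primes_1024 = [
    2, 3, 5, 7, 11, 13, 17, 19, 23, 29, 31, 37, 41, 43, 47, 53, 59, 61, 67, 71, 73, 79, 83, 89,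
    97, 101, 103, 107, 109, 113, 127, 131, 137, 139, 149, 151, 157, 163, 167, 173, 179, 181, 191,
    193, 197, 199, 211, 223, 227, 229, 233, 239, 241, 251, 257, 263, 269, 271, 277, 281, 283, 293,
    307, 311, 313, 317, 331, 337, 347, 349, 353, 359, 367, 373, 379, 383, 389, 397, 401, 409, 419,
    421, 431, 433, 439, 443, 449, 457, 461, 463, 467, 479, 487, 491, 499, 503, 509, 521, 523, 541,
    547, 557, 563, 569, 571, 577, 587, 593, 599, 601, 607, 613, 617, 619, 631, 641, 643, 647, 653,
    659, 661, 673, 677, 683, 691, 701, 709, 719, 727, 733, 739, 743, 751, 757, 761, 769, 773, 787,
    797, 809, 811, 821, 823, 827, 829, 839, 853, 857, 859, 863, 877, 881, 883, 887, 907, 911, 919,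
    929, 937, 941, 947, 953, 967, 971, 977, 983, 991, 997, 1009, 1013, 1019, 1021]"

text \<open>Trial division up to 31 decides primality below \<open>1024 = 32^2\<close>. The
  inclusion suffices, since sums and counts over the list serve as upper bounds.\<close>

lemma primes_1024_complete:
  assumes "prime r" "r < 1024"
  shows "r \<in> set primes_1024"
proof -
  define sieve where "sieve n \<longleftrightarrow> list_all (\<lambda>d. n mod d \<noteq> 0 \<or> n = d) [2, 3, 5, 7, 11, 13, 17, 19, 23, 29, 31]"
    for n :: nat
  have eq: "filter sieve [2..<1024] = primes_1024"
    unfolding sieve_def by code_simp
  have "r \<ge> 2" using assms(1) prime_ge_2_nat by blast
  moreover have "sieve r"
    unfolding sieve_def using assms(1) by (auto simp: prime_nat_iff mod_eq_0_iff_dvd)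
  ultimately have "r \<in> set (filter sieve [2..<1024])"
    unfolding set_filter set_upt mem_Collect_eq atLeastLessThan_iff using assms(2) by blast
  then show ?thesis unfolding eq .
qed

lemma primes_1024_sorted: "sorted_wrt (<) primes_1024"
  by (simp add: primes_1024_def sorted_wrt2 sorted_wrt1 del: sorted_wrt.simps(2))

lemma primes_1024_range: "\<forall>r\<in>set primes_1024. 2 \<le> r \<and> r < 1024"
  by code_simp

section \<open>Integer bounds for logarithms and the check of the table\<close>

lemma ln_le_tangent:
  assumes "r > 0"
  shows "ln r \<le> real e * ln 2 + r / 2 ^ e - 1"
proof -
  have "ln (r / 2 ^ e) \<le> r / 2 ^ e - 1" using assms by (intro ln_le_minus_one) simp
  moreover have "ln (r / 2 ^ e) = ln r - real e * ln 2" using assms by (simp add: ln_div ln_realpow)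
  ultimately show ?thesis by simp
qed

lemma ln_ge_chord:
  assumes "2 ^ e \<le> r" "r \<le> 2 ^ Suc e"
  shows "(real e + r / 2 ^ e - 1) * ln 2 \<le> ln r"
proof -
  define t where "t = r / 2 ^ e - 1"
  have t: "0 \<le> t" "t \<le> 1" using assms by (simp_all add: t_def field_simps)
  have "r > 0" using assms(1) less_le_trans[of 0 "2 ^ e" r] by simp
  have "(1 - t) * ln 1 + t * ln 2 \<le> ln ((1 - t) *\<^sub>R 1 + t *\<^sub>R (2::real))"
    using t concave_onD[OF ln_concave, of t 1 2] by simp
  then have "t * ln 2 \<le> ln (1 + t)" by (simp add: algebra_simps)
  also have "\<dots> = ln r - real e * ln 2" using \<open>r > 0\<close> by (simp add: t_def ln_div ln_realpow)
  finally show ?thesis by (simp add: t_def algebra_simps)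
qed

text \<open>The tangent of \<open>ln\<close> at \<open>2 ^ nearest_log2 r\<close>, with \<open>ln 2\<close> replaced by 0.6932, bounds \<open>ln r\<close>. To keep the
  evaluation in the integers, \<open>ln_upper\<close> is scaled by \<open>10000 * 1024 = 10240000\<close>. The constants in \<open>table_ok\<close> are
  \<open>1413120000 = 138 * 10240000\<close> and \<open>11724800000 = 1145 * 10240000\<close>.\<close>
definition nearest_log2 :: "nat \<Rightarrow> nat" where
  "nearest_log2 r = (if r < 3 then 1 else if r < 6 then 2 else if r < 12 then 3 else if r < 23 then 4 else if r < 46 then 5 else if r < 91 then 6 else if r < 182 then 7 else if r < 363 then 8 else if r < 725 then 9 else 10)"

definition ln_upper :: "nat \<Rightarrow> int" where
  "ln_upper r = int (nearest_log2 r) * 7098368 + 10000 * int r * 2 ^ (10 - nearest_log2 r) - 10240000"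

lemma nearest_log2_le: "nearest_log2 r \<le> 10"
  by (simp add: nearest_log2_def)

lemma ln_le_ln_upper:
  assumes "r > 0"
  shows "ln (real r) \<le> real_of_int (ln_upper r) / 10240000"
proof -
  define e where "e = nearest_log2 r"
  have "e \<le> 10" unfolding e_def by (rule nearest_log2_le)
  then have "(2::real) ^ (10 - e) = 1024 / 2 ^ e" by (simp add: power_diff)
  then have "real_of_int (ln_upper r) = (real e * (6932 / 10000) + real r / 2 ^ e - 1) * 10240000"
    by (simp add: ln_upper_def e_def[symmetric] algebra_simps)
  then have "real_of_int (ln_upper r) / 10240000 = real e * (6932 / 10000) + real r / 2 ^ e - 1"
    by (simp only: nonzero_mult_div_cancel_right zero_neq_numeral[symmetric] not_False_eq_True)
  moreover have "real e * ln 2 \<le> real e * (6932 / 10000)"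
    using ln_2_bounds by (intro mult_left_mono) auto
  moreover have "ln (real r) \<le> real e * ln 2 + real r / 2 ^ e - 1"
    using ln_le_tangent[of "real r" e] assms by simp
  ultimately show ?thesis by linarith
qed

text \<open>The accumulators \<open>i\<close> and \<open>t\<close> hold the number of earlier
  entries and the sum of their \<open>ln_upper\<close>, so one pass checks both bounds at every
  prime.\<close>

fun table_ok :: "int \<Rightarrow> int \<Rightarrow> nat list \<Rightarrow> bool" where
  "table_ok i t [] = True"
| "table_ok i t (r # rs) = (let u = ln_upper r in
     100 * ((i + 1) * u) \<le> 1413120000 * int r \<and> 1000 * (t + u) \<le> 11724800000 * int r
     \<and> table_ok (i + 1) (t + u) rs)"

lemma table_okD:
  assumes "table_ok i t rs" "j < length rs"
  shows "100 * ((i + int j + 1) * ln_upper (rs ! j)) \<le> 1413120000 * int (rs ! j)"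
    and "1000 * (t + (\<Sum>r\<leftarrow>take (Suc j) rs. ln_upper r)) \<le> 11724800000 * int (rs ! j)"
proof -
  have "100 * ((i + int j + 1) * ln_upper (rs ! j)) \<le> 1413120000 * int (rs ! j) \<and>
    1000 * (t + (\<Sum>r\<leftarrow>take (Suc j) rs. ln_upper r)) \<le> 11724800000 * int (rs ! j)"
    using assms
  proof (induction rs arbitrary: i t j)
    case (Cons r rs)
    show ?case
    proof (cases j)
      case 0
      then show ?thesis using Cons.prems by (simp add: Let_def)
    next
      case (Suc j')
      then show ?thesis using Cons.prems Cons.IH[of "i + 1" "t + ln_upper r" j']
        by (simp add: Let_def algebra_simps)
    qed
  qed simp
  then show "100 * ((i + int j + 1) * ln_upper (rs ! j)) \<le> 1413120000 * int (rs ! j)"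
    and "1000 * (t + (\<Sum>r\<leftarrow>take (Suc j) rs. ln_upper r)) \<le> 11724800000 * int (rs ! j)" by auto
qed

lemma table_ok_primes_1024: "table_ok 0 0 primes_1024"
  by code_simp

lemma primes_le_subset_take:
  assumes "j < length primes_1024"
  shows "{r. prime r \<and> r \<le> primes_1024 ! j} \<subseteq> set (take (Suc j) primes_1024)"
proof
  fix r assume r: "r \<in> {r. prime r \<and> r \<le> primes_1024 ! j}"
  then have "r < 1024" using primes_1024_range assms nth_mem by (metis le_less_trans mem_Collect_eq)
  then obtain l where l: "l < length primes_1024" "r = primes_1024 ! l"
    using primes_1024_complete r by (metis in_set_conv_nth mem_Collect_eq)
  then have "l \<le> j" using r primes_1024_sorted assms
    by (metis linorder_not_le mem_Collect_eq sorted_wrt_nth_less)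
  then show "r \<in> set (take (Suc j) primes_1024)" using l by (auto simp: in_set_conv_nth intro!: exI[of _ l])
qed

lemma sum_list_set_le:
  fixes g :: "nat \<Rightarrow> real"
  assumes "X \<subseteq> set xs" "\<And>r. r \<in> set xs \<Longrightarrow> g r \<ge> 0"
  shows "sum g X \<le> (\<Sum>r\<leftarrow>xs. g r)"
proof -
  have "sum g X \<le> sum g (set xs)" using assms by (intro sum_mono2) auto
  also have "\<dots> \<le> (\<Sum>r\<leftarrow>xs. g r)" using assms(2)
  proof (induction xs)
    case (Cons a xs)
    then show ?case by (cases "a \<in> set xs") (auto simp: insert_absorb intro: order_trans)
  qed simp
  finally show ?thesis .
qed

lemma sum_list_of_int_scaled:
  fixes w z :: real
  shows "(\<Sum>r\<leftarrow>rs. real_of_int (g r) / z) = real_of_int (\<Sum>r\<leftarrow>rs. g r) / z"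
    and "(\<Sum>r\<leftarrow>rs. real_of_int (g r) / z * w) = real_of_int (\<Sum>r\<leftarrow>rs. g r) / z * w"
  by (induction rs) (simp_all add: add_divide_distrib distrib_right)

lemma small_prime_bounds_at_prime:
  assumes "prime q" "q < 1024"
  shows "real (prime_pi q) * ln (real q) \<le> 69 / 50 * real q" and "theta q \<le> 229 / 200 * real q"
proof -
  obtain j where j: "j < length primes_1024" "q = primes_1024 ! j"
    using primes_1024_complete[OF assms] by (metis in_set_conv_nth)
  let ?T = "take (Suc j) primes_1024"
  have sub: "{r. prime r \<and> r \<le> q} \<subseteq> set ?T" using primes_le_subset_take j by simp
  note D = table_okD[OF table_ok_primes_1024 j(1), folded j(2)]
  have q2: "q \<ge> 2" using assms(1) prime_ge_2_nat by blast
  have "prime_pi q \<le> card (set ?T)" unfolding prime_pi_def using sub by (intro card_mono) auto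
  also have "\<dots> \<le> Suc j" using card_length[of ?T] by simp
  finally have pi: "real (prime_pi q) \<le> real j + 1" by simp
  have "real (prime_pi q) * ln (real q) \<le> (real j + 1) * (real_of_int (ln_upper q) / 10240000)"
    using pi q2 ln_le_ln_upper[of q] by (intro mult_mono) auto
  also have "\<dots> = real_of_int (100 * ((int j + 1) * ln_upper q)) / 1024000000" by simp
  also have "\<dots> \<le> real_of_int (1413120000 * int q) / 1024000000"
    using D(1) by (intro divide_right_mono) (simp_all only: of_int_le_iff, simp_all)
  also have "\<dots> = 69 / 50 * real q" by simp
  finally show "real (prime_pi q) * ln (real q) \<le> 69 / 50 * real q" .
  have "theta q \<le> (\<Sum>r\<leftarrow>?T. ln (real r))" unfolding theta_def
    using sub primes_1024_range by (intro sum_list_set_le) (auto dest!: in_set_takeD)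
  also have "\<dots> \<le> (\<Sum>r\<leftarrow>?T. real_of_int (ln_upper r) / 10240000)"
    using primes_1024_range by (intro sum_list_mono ln_le_ln_upper) (auto dest!: in_set_takeD)
  also have "\<dots> = real_of_int (1000 * (\<Sum>r\<leftarrow>?T. ln_upper r)) / 10240000000"
    by (simp add: sum_list_of_int_scaled)
  also have "\<dots> \<le> real_of_int (11724800000 * int q) / 10240000000"
    using D(2) by (intro divide_right_mono) (simp_all only: of_int_le_iff, simp_all)
  also have "\<dots> = 229 / 200 * real q" by simp
  finally show "theta q \<le> 229 / 200 * real q" .
qed

lemma div_ln_mono:
  fixes u v :: real
  assumes "exp 1 \<le> u" "u \<le> v"
  shows "u / ln u \<le> v / ln v"
proof -
  have u0: "u > 0" using assms(1) less_le_trans[OF exp_gt_zero] by blast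
  have lu: "ln u \<ge> 1" using assms(1) u0 by (simp add: ln_ge_iff)
  have "ln v - ln u = ln (v / u)" using assms u0 by (simp add: ln_div)
  also have "\<dots> \<le> v / u - 1" using assms u0 by (intro ln_le_minus_one) simp
  also have "\<dots> \<le> (v / u - 1) * ln u" using assms u0 lu by (simp add: mult_le_cancel_left1 le_divide_eq)
  finally have "ln v \<le> v / u * ln u" by (simp add: algebra_simps)
  then have "u * ln v \<le> v * ln u" using u0 by (simp add: field_simps)
  moreover have "ln v \<ge> 1" using lu assms u0 ln_mono[of u v] by linarith
  ultimately show ?thesis using lu by (simp add: field_simps)
qed

lemma exp_1_le_3: "exp 1 \<le> (3::real)"
  using ln_3_bounds(1) by (subst ln_ge_iff[symmetric]) auto

text \<open>Both functions are constant from the largest prime \<open>q <= n\<close> up to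
  \<open>n\<close>, so the bounds carry over from \<open>q\<close>. For \<open>prime_pi\<close> this
  uses that \<open>n / ln n\<close> increases, which holds only from \<open>exp 1\<close> on; hence
  \<open>n = 2\<close> is separate.\<close>

lemma small_prime_bounds:
  assumes "2 \<le> n" "n < 1024"
  shows "real (prime_pi n) * ln (real n) \<le> 69 / 50 * real n" and "theta n \<le> 229 / 200 * real n"
proof -
  define q where "q = Max {r. prime r \<and> r \<le> n}"
  have ne: "{r. prime r \<and> r \<le> n} \<noteq> {}" using assms(1) two_is_prime_nat by blast
  have q: "prime q" "q \<le> n" using Max_in[OF _ ne] unfolding q_def by auto
  have max: "r \<le> q" if "prime r" "r \<le> n" for r using that unfolding q_def by (intro Max_ge) auto
  have eq: "{r. prime r \<and> r \<le> n} = {r. prime r \<and> r \<le> q}" using max q by auto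
  have th: "theta n = theta q" and pi: "prime_pi n = prime_pi q"
    unfolding theta_def prime_pi_def eq by auto
  note b = small_prime_bounds_at_prime[OF q(1)]
  show "theta n \<le> 229 / 200 * real n" using b(2) q assms unfolding th by simp
  show "real (prime_pi n) * ln (real n) \<le> 69 / 50 * real n"
  proof (cases "n = 2")
    case True
    then show ?thesis using b(1) q prime_ge_2_nat[OF q(1)] by (simp add: pi mult.commute)
  next
    case False
    have "prime (3::nat)" by (simp add: prime_nat_numeral_eq)
    then have q3: "q \<ge> 3" using False assms(1) max[of 3] by simp
    then have "real q / ln (real q) \<le> real n / ln (real n)"
      using exp_1_le_3 q by (intro div_ln_mono) auto
    moreover have "real (prime_pi q) \<le> 69 / 50 * (real q / ln (real q))"
      using b(1) q assms q3 by (simp add: field_simps)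
    ultimately have "real (prime_pi q) \<le> 69 / 50 * (real n / ln (real n))" by linarith
    then show ?thesis unfolding pi using assms by (simp add: field_simps)
  qed
qed

section \<open>Starting value at 1024 for the partial summation\<close>

definition floor_log2 :: "nat \<Rightarrow> nat" where
  "floor_log2 r = (if r < 4 then 1 else if r < 8 then 2 else if r < 16 then 3 else if r < 32 then 4 else if r < 64 then 5 else if r < 128 then 6 else if r < 256 then 7 else if r < 512 then 8 else 9)"

lemma floor_log2:
  assumes "2 \<le> r" "r < 1024"
  shows "2 ^ floor_log2 r \<le> r" "r < 2 ^ Suc (floor_log2 r)" "floor_log2 r \<le> 9"
  using assms by (auto simp: floor_log2_def)

text \<open>The bound for \<open>ln (1024 / r)\<close> given by the chord of \<open>ln\<close>, scaled by \<open>1024 / ln 2\<close>.\<close>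
definition ln_ratio_upper :: "nat \<Rightarrow> int" where
  "ln_ratio_upper r = 1024 * (11 - int (floor_log2 r)) - int r * 2 ^ (10 - floor_log2 r)"

lemma sum_ln_ratio_upper: "(\<Sum>r\<leftarrow>primes_1024. ln_ratio_upper r) \<le> 318000"
  by code_simp

text \<open>The left side is the sum of \<open>ln (1024 / r)\<close> over the primes. Here
  \<open>ln r\<close> must be bounded from below, so chords replace the tangents used for the table;
  318000 / 1024 * 0.69315 is below 216.\<close>

lemma sum_ln_ratio_1024: "real (prime_pi 1024) * ln 1024 - theta 1024 \<le> 216"
proof -
  have d: "ln 1024 - ln (real r) \<le> real_of_int (ln_ratio_upper r) / 1024 * ln 2" and d0: "0 \<le> ln 1024 - ln (real r)"
    if "r \<in> set primes_1024" for r
  proof -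
    have r: "2 \<le> r" "r < 1024" using that primes_1024_range by auto
    note e = floor_log2[OF r]
    have "(2::real) ^ (10 - floor_log2 r) = 1024 / 2 ^ floor_log2 r" using e(3) by (simp add: power_diff)
    then have dr: "real_of_int (ln_ratio_upper r) / 1024 = 10 - (real (floor_log2 r) + real r / 2 ^ floor_log2 r - 1)"
      by (simp add: ln_ratio_upper_def field_simps)
    have "real (2 ^ floor_log2 r) \<le> real r" "real r \<le> real (2 ^ Suc (floor_log2 r))"
      using e by (simp_all only: of_nat_le_iff less_imp_le)
    then have "(real (floor_log2 r) + real r / 2 ^ floor_log2 r - 1) * ln 2 \<le> ln (real r)"
      by (intro ln_ge_chord) simp_all
    moreover have "ln 1024 = 10 * ln (2::real)" using ln_realpow[of 2 10] by simp
    ultimately show "ln 1024 - ln (real r) \<le> real_of_int (ln_ratio_upper r) / 1024 * ln 2"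
      unfolding dr left_diff_distrib by linarith
    show "0 \<le> ln 1024 - ln (real r)" using r by simp
  qed
  have even: "\<not> prime n" if "2 dvd n" "n > 2" for n :: nat
    using that by (metis nat_neq_iff primes_dvd_imp_eq two_is_prime_nat)
  have np: "\<not> prime (1024::nat)" by (rule even) simp_all
  have sub: "{r. prime r \<and> r \<le> 1024} \<subseteq> set primes_1024"
  proof
    fix r :: nat assume "r \<in> {r. prime r \<and> r \<le> 1024}"
    then have "prime r" "r \<le> 1024" by auto
    moreover from this have "r \<noteq> 1024" using np by blast
    ultimately show "r \<in> set primes_1024" by (intro primes_1024_complete) linarith+
  qed
  have "real (prime_pi 1024) * ln 1024 - theta 1024 = (\<Sum>r | prime r \<and> r \<le> 1024. ln 1024 - ln (real r))"
    by (simp add: prime_pi_def theta_def sum_subtractf)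
  also have "\<dots> \<le> (\<Sum>r\<leftarrow>primes_1024. ln 1024 - ln (real r))"
    by (rule sum_list_set_le[OF sub, of "\<lambda>r. ln 1024 - ln (real r)"]) (rule d0)
  also have "\<dots> \<le> (\<Sum>r\<leftarrow>primes_1024. real_of_int (ln_ratio_upper r) / 1024 * ln 2)"
    by (rule sum_list_mono) (rule d)
  also have "\<dots> = real_of_int (\<Sum>r\<leftarrow>primes_1024. ln_ratio_upper r) / 1024 * ln 2"
    by (rule sum_list_of_int_scaled(2))
  also have "\<dots> \<le> 318000 / 1024 * (69315 / 100000)"
  proof (rule mult_mono)
    have "real_of_int (\<Sum>r\<leftarrow>primes_1024. ln_ratio_upper r) \<le> 318000"
      using sum_ln_ratio_upper by linarith
    then show "real_of_int (\<Sum>r\<leftarrow>primes_1024. ln_ratio_upper r) / 1024 \<le> 318000 / 1024"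
      by (rule divide_right_mono) simp
  qed (use ln_2_bounds in simp_all)
  also have "\<dots> \<le> 216" by simp
  finally show ?thesis .
qed

section \<open>An upper bound for the prime counting function\<close>

text \<open>Iterating \<open>theta_30\<close> alone would give the slope 6/5 * 27.64 / 30, about
  1.106. The larger 1.145 absorbs rounding \<open>n\<close> up to a multiple of 30, which is
  affordable from 1024 on; below, the table applies.\<close>

lemma theta_le: "theta n \<le> 229 / 200 * real n"
proof (induction n rule: less_induct)
  case (less n)
  consider "n < 2" | "2 \<le> n" "n < 1024" | "n \<ge> 1024" by linarith
  then show ?case
  proof cases
    case 1
    then have none: "{r. prime r \<and> r \<le> n} = {}" by (auto dest: prime_ge_2_nat)
    show ?thesis unfolding theta_def none by simp
  next
    case 2
    then show ?thesis by (rule small_prime_bounds)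
  next
    case 3
    define N where "N = (n + 29) div 30"
    have N: "n \<le> 30 * N" "30 * N \<le> n + 29" unfolding N_def by linarith+
    have "theta n \<le> theta (30 * N)" using N(1) by (rule theta_mono)
    also have "\<dots> \<le> theta (5 * N) + 691 / 25 * real N" by (rule theta_30)
    also have "theta (5 * N) \<le> 229 / 200 * real (5 * N)"
      using N 3 by (intro less) linarith
    finally have "theta n \<le> 6673 / 200 * real N" by simp
    moreover have "30 * real N \<le> real n + 29" using N(2) by linarith
    ultimately show ?thesis using 3 by simp
  qed
qed

text \<open>Partial summation: \<open>prime_pi n * ln n - theta n\<close> is the integral of \<open>prime_pi t / t\<close>.\<close>
lemma prime_pi_ln_minus_theta_Suc:
  assumes "n > 0"
  shows "real (prime_pi (Suc n)) * ln (real (Suc n)) - theta (Suc n) =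
    real (prime_pi n) * ln (real n) - theta n + real (prime_pi n) * (ln (real (Suc n)) - ln (real n))"
  by (simp add: prime_pi_Suc theta_Suc algebra_simps)

lemma ln_Suc_le:
  assumes "n > 0"
  shows "ln (real (Suc n)) \<le> ln (real n) + 1 / real n"
proof -
  have "real (Suc n) / real n = 1 + 1 / real n" using assms by (simp add: field_simps)
  then have "ln (real (Suc n)) - ln (real n) = ln (1 + 1 / real n)"
    using assms ln_div[of "real (Suc n)" "real n"] by simp
  also have "\<dots> \<le> 1 / real n" by (rule ln_add_one_self_le_self) simp
  finally show ?thesis by simp
qed

text \<open>The derivative of \<open>n / ln n\<close> is \<open>(1 - 1 / ln n) / ln n\<close>. At
  1024 the bracket is about 0.8557; the slightly smaller 0.8551 covers the discrete step.\<close>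

lemma div_ln_Suc_ge:
  assumes "n \<ge> 1024"
  shows "real n / ln (real n) + 8551 / 10000 / ln (real n) \<le> real (Suc n) / ln (real (Suc n))"
proof -
  define L where "L = ln (real n)"
  have "ln 1024 = 10 * ln (2::real)" using ln_realpow[of 2 10] by simp
  moreover have "ln 1024 \<le> L" unfolding L_def using assms by simp
  ultimately have L: "L \<ge> 6931 / 1000" using ln_2_bounds(1) by simp
  have n: "real n \<ge> 1024" using assms by simp
  have "8551 / 10000 * (L + 1 / 1024) \<le> L - 1" using L by simp
  moreover have "8551 / 10000 * (L + 1 / real n) \<le> 8551 / 10000 * (L + 1 / 1024)"
    using n by (simp add: field_simps)
  ultimately have step: "8551 / 10000 * (L + 1 / real n) \<le> L - 1" by linarith
  have "(real n + 8551 / 10000) * (L + 1 / real n) = real n * L + 1 + 8551 / 10000 * (L + 1 / real n)"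
    using n by (simp add: field_simps)
  also have "\<dots> \<le> real (Suc n) * L" using step by (simp add: algebra_simps)
  finally have "(real n + 8551 / 10000) / L \<le> real (Suc n) / (L + 1 / real n)"
    using L n by (simp add: divide_simps) (simp add: algebra_simps)?
  also have "\<dots> \<le> real (Suc n) / ln (real (Suc n))"
    using ln_Suc_le[of n] n L unfolding L_def by (intro frac_le) auto
  finally show ?thesis unfolding L_def by (simp add: add_divide_distrib)
qed

text \<open>The two claims feed each other. The first at \<open>n\<close> gives the second through
  \<open>theta_le\<close>, as 1.614 / 6.931 + 1.145 < 1.38. The second bounds the next increment by
  \<open>1.38 / ln n\<close>, which the growth \<open>1.614 * 0.8551 / ln n\<close> of the right
  side covers.\<close>

lemma prime_pi_ln_minus_theta_le:
  assumes "n \<ge> 1024"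
  shows "real (prime_pi n) * ln (real n) - theta n \<le> 807 / 500 * (real n / ln (real n))"
    and "real (prime_pi n) * ln (real n) \<le> 69 / 50 * real n"
proof -
  have bound: "real (prime_pi n) * ln (real n) \<le> 69 / 50 * real n"
    if n: "n \<ge> 1024" and D: "real (prime_pi n) * ln (real n) - theta n \<le> 807 / 500 * (real n / ln (real n))" for n
  proof -
    have "ln 1024 = 10 * ln (2::real)" using ln_realpow[of 2 10] by simp
    moreover have "ln 1024 \<le> ln (real n)" using n by simp
    ultimately have L: "ln (real n) \<ge> 6931 / 1000" using ln_2_bounds(1) by simp
    have "real n / ln (real n) \<le> real n / (6931 / 1000)" using L by (intro divide_left_mono) auto
    then show ?thesis using D theta_le[of n] by simp
  qed
  have "real (prime_pi n) * ln (real n) - theta n \<le> 807 / 500 * (real n / ln (real n))"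
    using assms
  proof (induction n rule: dec_induct)
    case base
    have l: "ln 1024 = 10 * ln (2::real)" using ln_realpow[of 2 10] by simp
    have "216 * ln 1024 \<le> (807 / 500 * 1024 :: real)" unfolding l using ln_2_bounds(2) by simp
    then have "(216::real) \<le> 807 / 500 * (1024 / ln 1024)" by (simp add: field_simps)
    then show ?case using sum_ln_ratio_1024 by simp
  next
    case (step n)
    have n: "n > 0" "n \<ge> 1024" "real n > 1" using step(1) by linarith+
    have l: "ln (real n) > 0" using n(3) by simp
    have "real (prime_pi n) \<le> 69 / 50 * (real n / ln (real n))"
      using bound[OF n(2) step.IH] l by (simp add: field_simps)
    then have "real (prime_pi n) * (ln (real (Suc n)) - ln (real n))
        \<le> (69 / 50 * (real n / ln (real n))) * (1 / real n)"
      using ln_Suc_le[of n] n by (intro mult_mono) auto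
    also have "\<dots> = 69 / 50 / ln (real n)" using n by simp
    also have "\<dots> \<le> 807 / 500 * (8551 / 10000 / ln (real n))" using l by (simp add: field_simps)
    finally show ?case
      using prime_pi_ln_minus_theta_Suc[OF n(1)] step.IH div_ln_Suc_ge[OF n(2)] by linarith
  qed
  then show "real (prime_pi n) * ln (real n) - theta n \<le> 807 / 500 * (real n / ln (real n))"
    and "real (prime_pi n) * ln (real n) \<le> 69 / 50 * real n"
    using bound[OF assms] by blast+
qed

theorem prime_pi_le:
  assumes "n \<ge> 2"
  shows "real (prime_pi n) * ln (real n) \<le> 69 / 50 * real n"
  using small_prime_bounds(1)[of n] prime_pi_ln_minus_theta_le(2)[of n] assms by linarith

section \<open>Counting representations\<close>

lemma infinite_primes_nat: "infinite {q::nat. prime q}"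
  using primes_infinite by simp

lemma p_prime: "prime (p t)"
  using enumerate_in_set[OF infinite_primes_nat] unfolding p_def by blast

lemma p_less: "1 \<le> i \<Longrightarrow> i < j \<Longrightarrow> p i < p j"
  unfolding p_def using infinite_primes_nat by (intro enumerate_mono) auto

lemma p_mono: "1 \<le> i \<Longrightarrow> i \<le> j \<Longrightarrow> p i \<le> p j"
  using p_less[of i j] by (cases "i = j") auto

lemma p_ge: "1 \<le> t \<Longrightarrow> Suc t \<le> p t"
proof (induction t rule: nat_induct_at_least)
  case base
  then show ?case using prime_ge_2_nat[OF p_prime[of 1]] by simp
next
  case (Suc t)
  then show ?case using p_less[of t "Suc t"] by simp
qed

text \<open>If a sum of \<open>m\<close> consecutive prime powers starting at index \<open>t\<close> is at most \<open>x\<close>, then \<open>t\<close> lies in this set.\<close>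
definition starts :: "nat \<Rightarrow> real \<Rightarrow> nat \<Rightarrow> nat set" where
  "starts k x m = {t. 1 \<le> t \<and> real m * real (p t) ^ k \<le> x}"

lemma index_le_p_power: "1 \<le> t \<Longrightarrow> 1 \<le> k \<Longrightarrow> t \<le> p t ^ k"
  using p_ge[of t] self_le_power[of "p t" k] by linarith

lemma finite_starts:
  assumes "1 \<le> k" "1 \<le> m"
  shows "finite (starts k x m)"
proof (rule finite_subset)
  show "starts k x m \<subseteq> {..nat \<lfloor>x\<rfloor>}"
  proof
    fix t assume "t \<in> starts k x m"
    then have t: "1 \<le> t" "real m * real (p t) ^ k \<le> x" by (auto simp: starts_def)
    have "real t \<le> real (p t ^ k)" using index_le_p_power[OF t(1) assms(1)] of_nat_le_iff by blast
    also have "\<dots> \<le> real m * real (p t) ^ k" using assms(2) mult_right_mono[of 1 "real m" "real (p t) ^ k"] by simp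
    finally show "t \<in> {..nat \<lfloor>x\<rfloor>}" using t(2) by (simp add: le_nat_floor)
  qed
qed simp

lemma sum_powers_ge:
  assumes "1 \<le> i"
  shows "real m * real (p i) ^ k \<le> (\<Sum>t=i..<i+m. real (p t) ^ k)"
proof -
  have "(\<Sum>t=i..<i+m. real (p i) ^ k) \<le> (\<Sum>t=i..<i+m. real (p t) ^ k)"
    using assms p_mono by (intro sum_mono power_mono) auto
  then show ?thesis by simp
qed

definition reps :: "nat \<Rightarrow> real \<Rightarrow> (nat \<times> nat) set" where
  "reps k x = {(i, j). 1 \<le> i \<and> i \<le> j \<and> (\<Sum>t=i..j. real (p t) ^ k) \<le> x}"

lemma finite_reps:
  assumes "1 \<le> k"
  shows "finite (reps k x)"
proof (rule finite_subset)
  show "reps k x \<subseteq> starts k x 1 \<times> starts k x 1"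
  proof (clarify)
    fix i j assume "(i, j) \<in> reps k x"
    then have ij: "1 \<le> i" "i \<le> j" "(\<Sum>t=i..j. real (p t) ^ k) \<le> x" by (auto simp: reps_def)
    have "real (p t) ^ k \<le> x" if "t \<in> {i..j}" for t
      using member_le_sum[of t "{i..j}" "\<lambda>t. real (p t) ^ k"] that ij by simp
    then show "i \<in> starts k x 1 \<and> j \<in> starts k x 1" using ij by (auto simp: starts_def)
  qed
  show "finite (starts k x 1 \<times> starts k x 1)" using finite_starts[of k 1 x] assms by simp
qed

lemma s_le_card_reps:
  assumes "1 \<le> k"
  shows "s k x \<le> card (reps k x)"
proof -
  define N where "N = {n::nat. 1 \<le> n \<and> real n \<le> x}"
  define R where "R n = {(i, j). 1 \<le> i \<and> i \<le> j \<and> (\<Sum>t=i..j. p t ^ k) = n}" for n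
  have finN: "finite N" unfolding N_def
    by (rule finite_subset[of _ "{..nat \<lfloor>x\<rfloor>}"]) (auto simp: le_nat_floor)
  have sub: "R n \<subseteq> reps k x" if "n \<in> N" for n
  proof (clarify)
    fix i j assume ij: "(i, j) \<in> R n"
    then have "(\<Sum>t=i..j. real (p t) ^ k) = real n" unfolding R_def by force
    then show "(i, j) \<in> reps k x" using ij that by (auto simp: reps_def R_def N_def)
  qed
  have "s k x = (\<Sum>n\<in>N. card (R n))" by (simp add: s_def f_def N_def R_def)
  also have "\<dots> = card (\<Union>n\<in>N. R n)"
    using finN finite_subset[OF sub finite_reps[OF assms]]
    by (intro card_UN_disjoint[symmetric]) (auto simp: R_def)
  also have "\<dots> \<le> card (reps k x)"
    using sub finite_reps[OF assms] by (intro card_mono) auto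
  finally show ?thesis .
qed

text \<open>Representations of length at most \<open>q\<close> are counted by their starting index. In a longer one, both the
  starting index \<open>i\<close> and the index \<open>j - q + 1 > i\<close> at which the last \<open>q\<close> terms begin lie in
  \<open>starts k x q\<close>, so these representations inject into the two-element subsets.\<close>
lemma card_reps_le:
  assumes "1 \<le> k" "1 \<le> q"
  shows "card (reps k x) \<le> (\<Sum>m=1..q. card (starts k x m)) + (card (starts k x q) choose 2)"
proof -
  define X where "X m = (\<lambda>i. (i, i + m - 1)) ` starts k x m" for m
  define Y where "Y = {ij \<in> reps k x. snd ij \<ge> fst ij + q}"
  define h where "h ij = {fst ij, Suc (snd ij) - q}" for ij :: "nat \<times> nat"
  have "reps k x \<subseteq> (\<Union>m\<in>{1..q}. X m) \<union> Y"
  proof (clarify)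
    fix i j assume ij: "(i, j) \<in> reps k x" "(i, j) \<notin> Y"
    define m where "m = Suc j - i"
    have "{i..j} = {i..<i + m}" using ij by (auto simp: m_def reps_def)
    then have "i \<in> starts k x m" using ij sum_powers_ge[of i m k] by (auto simp: starts_def reps_def)
    moreover have "m \<in> {1..q}" "j = i + m - 1" using ij by (auto simp: m_def Y_def reps_def)
    ultimately show "(i, j) \<in> (\<Union>m\<in>{1..q}. X m)" by (auto simp: X_def)
  qed
  moreover have finX: "finite (\<Union>m\<in>{1..q}. X m)" unfolding X_def using assms finite_starts by auto
  moreover have finY: "finite Y" unfolding Y_def using finite_reps[OF assms(1)] by simp
  ultimately have "card (reps k x) \<le> card (\<Union>m\<in>{1..q}. X m) + card Y"
    by (meson card_Un_le card_mono finite_UnI order_trans)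
  moreover have "card (\<Union>m\<in>{1..q}. X m) \<le> (\<Sum>m=1..q. card (X m))"
    by (rule card_UN_le) simp
  moreover have "(\<Sum>m=1..q. card (X m)) \<le> (\<Sum>m=1..q. card (starts k x m))"
    unfolding X_def using assms finite_starts by (intro sum_mono card_image_le) auto
  moreover have "card Y \<le> card {Z. Z \<subseteq> starts k x q \<and> card Z = 2}"
  proof (rule card_inj_on_le)
    show "inj_on h Y"
    proof (rule inj_onI, clarify)
      fix i j i' j' assume *: "(i, j) \<in> Y" "(i', j') \<in> Y" "h (i, j) = h (i', j')"
      \<comment> \<open>The starting index is the smaller element, so the unordered pair determines
        \<open>i\<close> and \<open>j\<close>.\<close>
      then have "i < Suc j - q" "i' < Suc j' - q" "q \<le> j" "q \<le> j'" by (auto simp: Y_def)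
      then show "i = i' \<and> j = j'" using *(3) unfolding h_def by (auto simp: doubleton_eq_iff)
    qed
    show "h ` Y \<subseteq> {Z. Z \<subseteq> starts k x q \<and> card Z = 2}"
    proof (clarify)
      fix i j assume "(i, j) \<in> Y"
      then have ij: "1 \<le> i" "i + q \<le> j" "(\<Sum>t=i..j. real (p t) ^ k) \<le> x" by (auto simp: Y_def reps_def)
      define t where "t = Suc j - q"
      have t: "i < t" "t + q = Suc j" using ij assms(2) by (auto simp: t_def)
      have "real q * real (p t) ^ k \<le> (\<Sum>u=t..<t+q. real (p u) ^ k)"
        using t ij by (intro sum_powers_ge) simp
      also have "\<dots> \<le> (\<Sum>u=i..j. real (p u) ^ k)" using t by (intro sum_mono2) auto
      finally have tx: "real q * real (p t) ^ k \<le> x" using ij(3) by linarith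
      have "real q * real (p i) ^ k \<le> real q * real (p t) ^ k"
        using p_mono[of i t] t ij by (intro mult_left_mono power_mono) auto
      then have "i \<in> starts k x q" "t \<in> starts k x q" using tx t ij by (auto simp: starts_def)
      then show "h (i, j) \<subseteq> starts k x q \<and> card (h (i, j)) = 2"
        using t by (auto simp: h_def t_def)
    qed
    show "finite {Z. Z \<subseteq> starts k x q \<and> card Z = 2}"
      using finite_starts[of k q x] assms by simp
  qed
  moreover have "card {Z. Z \<subseteq> starts k x q \<and> card Z = 2} = card (starts k x q) choose 2"
    using finite_starts[of k q x] assms by (intro n_subsets) auto
  ultimately show ?thesis by linarith
qed

lemma s_le:
  assumes "1 \<le> k" "1 \<le> q"
  shows "real (s k x) \<le> (\<Sum>m=1..q. real (card (starts k x m)))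
    + real (card (starts k x q)) * (real (card (starts k x q)) - 1) / 2"
proof -
  have ch: "real (n choose 2) = real n * (real n - 1) / 2" for n :: nat
    by (cases n) (simp_all add: choose_two real_of_nat_div algebra_simps)
  have "s k x \<le> (\<Sum>m=1..q. card (starts k x m)) + (card (starts k x q) choose 2)"
    using s_le_card_reps[OF assms(1)] card_reps_le[OF assms] order_trans by blast
  then have "real (s k x) \<le> real ((\<Sum>m=1..q. card (starts k x m)) + (card (starts k x q) choose 2))"
    by (rule of_nat_mono)
  then show ?thesis by (simp only: of_nat_add of_nat_sum ch)
qed

text \<open>The primes counted are at most \<open>y = (x / m) powr (1 / k)\<close>. The hypothesis
  on \<open>m\<close> gives \<open>ln y >= ln x / (k + 1)\<close>, a denominator independent of
  \<open>m\<close>, and \<open>7 ^ k <= x\<close> puts \<open>y\<close> above 3, where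
  \<open>y / ln y\<close> increases.\<close>

lemma card_starts_le:
  fixes x :: real
  assumes "2 \<le> k" "1 \<le> m" "real m ^ (k + 1) \<le> x" "7 ^ k \<le> x"
  shows "real (card (starts k x m)) \<le>
    69 / 50 * (real k + 1) * x powr (1 / real k) / ln x * real m powr (- 1 / real k)"
proof -
  define y where "y = (x / real m) powr (1 / real k)"
  have x7: "x \<ge> 7" using assms(1,4) self_le_power[of "7::real" k] by simp
  have lx: "real k * ln 7 \<le> ln x" using assms(4) x7 by (simp flip: ln_realpow)
  \<comment> \<open>This is 27 <= 49; it is needed because \<open>k + 1\<close> can be as large as
    \<open>3 / 2 * k\<close>, namely at \<open>k = 2\<close>.\<close>
  have l7: "3 * ln 3 \<le> 2 * ln (7::real)"
  proof -
    have "ln (3 ^ 3) \<le> ln ((7::real) ^ 2)" by simp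
    then show ?thesis by (simp only: ln_realpow of_nat_numeral)
  qed
  have "(real k + 1) * ln (real m) \<le> ln x"
    using assms(2,3) ln_mono[of "real m ^ (k + 1)" x] by (simp only: ln_realpow) (simp add: add.commute)
  then have lnm: "ln x / (real k + 1) \<le> (ln x - ln (real m)) / real k"
    using assms(1) by (simp add: field_simps)
  have "y > 0" unfolding y_def using x7 assms(2) by simp
  have lny: "ln y = (ln x - ln (real m)) / real k"
    unfolding y_def using x7 assms(2) by (simp add: ln_powr ln_div)
  have "ln 3 * (real k + 1) \<le> real k * ln 7"
  proof -
    have "ln 3 * (real k + 1) \<le> ln 3 * (3 / 2 * real k)" using assms(1) by (intro mult_left_mono) auto
    also have "\<dots> = real k / 2 * (3 * ln 3)" by simp
    also have "\<dots> \<le> real k / 2 * (2 * ln 7)" using l7 by (rule mult_left_mono) simp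
    finally show ?thesis by simp
  qed
  then have "ln 3 \<le> ln x / (real k + 1)" using lx by (simp add: le_divide_eq)
  then have "ln 3 \<le> ln y" using lny lnm by linarith
  then have y3: "3 \<le> y" using \<open>y > 0\<close> by simp
  define n where "n = nat \<lfloor>y\<rfloor>"
  have n: "3 \<le> n" "real n \<le> y" unfolding n_def using y3 by (simp_all add: le_nat_floor)
  have "card (starts k x m) \<le> prime_pi n" unfolding prime_pi_def
  proof (rule card_inj_on_le[where f = p])
    show "inj_on p (starts k x m)"
      using p_less by (intro linorder_inj_onI) (auto simp: starts_def dest: less_imp_neq)
    show "p ` starts k x m \<subseteq> {r. prime r \<and> r \<le> n}"
    proof (clarify, intro conjI p_prime)
      fix t assume "t \<in> starts k x m"
      then have "real (p t) ^ k \<le> x / real m" using assms(2) by (simp add: starts_def field_simps)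
      then have "(real (p t) ^ k) powr (1 / real k) \<le> y" unfolding y_def by (intro powr_mono2) auto
      moreover have "(real (p t) ^ k) powr (1 / real k) = real (p t)"
        using assms(1) prime_gt_0_nat[OF p_prime[of t]] by (simp add: powr_realpow[symmetric] powr_powr)
      ultimately show "p t \<le> n" unfolding n_def by (simp add: le_nat_floor)
    qed
  qed simp
  then have "real (card (starts k x m)) \<le> real (prime_pi n)" by simp
  also have "\<dots> \<le> 69 / 50 * (real n / ln (real n))" using prime_pi_le[of n] n by (simp add: field_simps)
  also have "\<dots> \<le> 69 / 50 * (y / ln y)"
    using div_ln_mono[of "real n" y] n exp_1_le_3 by simp
  also have "y / ln y \<le> y / (ln x / (real k + 1))"
    using y3 lny lnm x7 by (intro frac_le) auto
  also have "69 / 50 * (y / (ln x / (real k + 1))) = 69 / 50 * (real k + 1) * y / ln x" by simp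
  also have "y = x powr (1 / real k) * real m powr (- 1 / real k)"
    unfolding y_def using x7 assms(2) by (simp add: powr_divide powr_minus_divide)
  finally show ?thesis by (simp add: mult_ac)
qed

section \<open>Comparison with the target\<close>

lemma powr_le_tangent:
  fixes u :: real
  assumes "0 \<le> b" "b \<le> 1" "0 < u"
  shows "u powr b \<le> 1 + b * (u - 1)"
  using Youngs_inequality_0[of b "1 - b" u 1] assms by (simp add: algebra_simps)

text \<open>Comparison with the integral in telescoping form: the tangent at \<open>q + 1\<close> to
  the concave function \<open>u powr b\<close> bounds each term by a difference of consecutive
  values.\<close>

lemma sum_powr_le:
  fixes b :: real
  assumes "0 < b" "b \<le> 1"
  shows "(\<Sum>m=1..q. real m powr (b - 1)) \<le> real q powr b / b"
proof (induction q)
  case (Suc q)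
  have "real q powr b \<le> real (Suc q) powr b - b * real (Suc q) powr (b - 1)"
  proof (cases "q = 0")
    case False
    have "(real q / real (Suc q)) powr b \<le> 1 + b * (real q / real (Suc q) - 1)"
      using assms False by (intro powr_le_tangent) auto
    also have "real q / real (Suc q) - 1 = - 1 / real (Suc q)" by (simp add: field_simps)
    finally have "real q powr b / real (Suc q) powr b \<le> 1 - b / real (Suc q)"
      by (simp add: powr_divide)
    then have "real q powr b \<le> (1 - b / real (Suc q)) * real (Suc q) powr b"
      by (simp add: divide_le_eq del: of_nat_Suc)
    also have "real (Suc q) powr (b - 1) = real (Suc q) powr b / real (Suc q)"
      by (simp add: powr_diff del: of_nat_Suc)
    then have "(1 - b / real (Suc q)) * real (Suc q) powr b = real (Suc q) powr b - b * real (Suc q) powr (b - 1)"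
      by (simp add: algebra_simps del: of_nat_Suc)
    finally show ?thesis .
  qed (use assms in simp)
  then have "(real q powr b + b * real (Suc q) powr (b - 1)) / b \<le> real (Suc q) powr b / b"
    using assms(1) by (intro divide_right_mono) auto
  then have "real q powr b / b + real (Suc q) powr (b - 1) \<le> real (Suc q) powr b / b"
    using assms(1) by (simp add: add_divide_distrib del: of_nat_Suc)
  then show ?case using Suc by simp
qed simp

lemma U_ge:
  fixes y :: real
  assumes "2 \<le> k" "6 \<le> y"
  shows "1.25506 * 4 powr ((real k - 1) / (real k * (real k + 1))) * ((real k + 1) / real k) \<le> U y k"
proof -
  have y3: "exp 1 \<le> y" using exp_1_le_3 assms(2) by linarith
  then have ly: "ln y \<ge> 1" using assms(2) by (subst ln_ge_iff) auto
  have B1: "1 \<le> B y k"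
  proof -
    have "1 \<le> ln (y + 1) / ln y" using ly assms(2) by simp
    moreover have "exp 1 \<le> (y + 1)\<^sup>2"
      using y3 assms(2) self_le_power[of "y + 1" 2] by simp
    then have "1 \<le> ln ((y + 1)\<^sup>2)" using assms(2) by (subst ln_ge_iff) auto
    then have "0 \<le> ln (ln ((y + 1)\<^sup>2)) / ln y * (real k / (real k + 1))" using ly by simp
    ultimately show ?thesis unfolding B_def by linarith
  qed
  have C1: "1 \<le> C y k"
    unfolding C_def using B1 assms(2) ge_one_powr_ge_zero[of "y / (y - 1)" "1 / (real k + 1)"]
      ge_one_powr_ge_zero[of "B y k" "real k / (real k + 1)"]
      mult_mono[of 1 "(y / (y - 1)) powr (1 / (real k + 1))" 1 "B y k powr (real k / (real k + 1))"]
    by simp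
  \<comment> \<open>The lower bound, equivalent to \<open>8 < y^2\<close>, keeps the denominator of
    \<open>E\<close> positive for \<open>k >= 2\<close>; the upper bound makes that denominator at
    most \<open>k\<close>.\<close>
  have A: "1 / 3 < A y" "A y \<le> 1"
  proof -
    have "y < (y / 2) ^ 3"
    proof -
      have "y * 8 < y * y\<^sup>2" using assms(2) power_mono[of 6 y 2] by (intro mult_strict_left_mono) auto
      then show ?thesis by (simp add: power3_eq_cube power2_eq_square)
    qed
    then have "ln y < ln ((y / 2) ^ 3)" using assms(2) by (subst ln_less_cancel_iff) auto
    then have "ln y < 3 * ln (y / 2)" by (simp only: ln_realpow of_nat_numeral)
    then show "1 / 3 < A y" unfolding A_def using ly by (simp add: field_simps)
    have "ln (y / 2) \<le> ln y" using assms(2) by (intro ln_mono) auto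
    then show "A y \<le> 1" unfolding A_def using ly by simp
  qed
  have "0 < (real k + 1) * A y - 1"
  proof -
    have "(real k + 1) * (1 / 3) < (real k + 1) * A y" using A by (intro mult_strict_left_mono) auto
    moreover have "1 \<le> (real k + 1) * (1 / 3)" using assms(1) by simp
    ultimately show ?thesis by linarith
  qed
  moreover have "(real k + 1) * A y - 1 \<le> real k"
  proof -
    have "(real k + 1) * A y \<le> (real k + 1) * 1" using A by (intro mult_left_mono) auto
    then show ?thesis by (simp add: algebra_simps)
  qed
  ultimately have "1 / real k \<le> 1 / ((real k + 1) * A y - 1)" by (intro divide_left_mono) auto
  then have E1: "(real k + 1) / real k \<le> E y k" unfolding E_def using assms(1) by (simp add: add_divide_distrib)
  have k1: "0 \<le> (real k - 1) / real k" using assms(1) by simp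
  have "1 \<le> ((y + 1) / y) powr ((real k - 1) / real k)"
    using assms k1 by (intro ge_one_powr_ge_zero) auto
  moreover have "1 \<le> C y k powr ((real k - 1) / real k)"
    using C1 k1 by (intro ge_one_powr_ge_zero)
  ultimately have "1 * 4 powr ((real k - 1) / (real k * (real k + 1))) * 1 * ((real k + 1) / real k) \<le> F y k"
    unfolding F_def using E1 by (intro mult_mono) auto
  then have "1.25506 * (1 * 4 powr ((real k - 1) / (real k * (real k + 1))) * 1 * ((real k + 1) / real k)) \<le> 1.25506 * F y k"
    by (rule mult_left_mono) simp
  then show ?thesis unfolding U_def by (simp only: mult_1 mult_1_right mult.assoc)
qed

section \<open>Numerical inequalities in \<open>k\<close> and \<open>r\<close>\<close>

lemma ln_85_69: "ln (85 / 69) \<le> (2086 / 10000 :: real)"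
  using ln_approx_bounds[of "85 / 69" 2] by (simp add: eval_nat_numeral)

text \<open>By concavity; the chord has slope at least 0.912 / 1.52 = 3/5. The endpoint 63/25 bounds
  \<open>2 powr (4/3)\<close>, hence every \<open>w\<close> in \<open>long_target\<close>, where
  \<open>k >= 3\<close>.\<close>

lemma ln_ge_secant:
  fixes w :: real
  assumes "1 \<le> w" "w \<le> 63 / 25"
  shows "3 / 5 * (w - 1) \<le> ln w"
proof -
  have l: "912 / 1000 \<le> ln (63 / 25 :: real)"
    using ln_approx_bounds[of "63 / 25" 4] by (simp add: eval_nat_numeral)
  define t where "t = (w - 1) / (38 / 25)"
  have t: "0 \<le> t" "t \<le> 1" "w = 1 + t * (38 / 25)" using assms by (simp_all add: t_def field_simps)
  have "(1 - t) * ln 1 + t * ln (63 / 25) \<le> ln ((1 - t) *\<^sub>R 1 + t *\<^sub>R (63 / 25 :: real))"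
    using t concave_onD[OF ln_concave, of t 1 "63 / 25"] by simp
  also have "(1 - t) *\<^sub>R 1 + t *\<^sub>R (63 / 25 :: real) = w" using t(3) by simp
  finally have "t * ln (63 / 25) \<le> ln w" by simp
  moreover have "t * (912 / 1000) \<le> t * ln (63 / 25)" using l t by (intro mult_left_mono)
  ultimately show ?thesis using t(3) by simp
qed

text \<open>Here \<open>85 / 69\<close> is \<open>17 / 10\<close>, the bound imposed on \<open>P q / (q * k)\<close> by the choice of \<open>q\<close>, divided by the
  constant \<open>69 / 50\<close> of \<open>prime_pi_le\<close>.\<close>
definition log_gap :: "real \<Rightarrow> real" where
  "log_gap k = 2 * ln k + 2 * ln (85 / 69) - (1 - 1 / k) * ln (4 * (k + 1))"

text \<open>At \<open>r = 17/10 * k\<close> the value of \<open>target_exp\<close> is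
  \<open>- log_gap k / (k + 1)\<close>, so these are the long and the short comparison there, with
  \<open>exp\<close> replaced by its tangent at 0. The 7/12 is \<open>(1 + 1 / r) / 2\<close> at
  \<open>r = 6\<close>.\<close>

lemma log_gap_le:
  fixes k :: nat
  assumes "k \<ge> 3"
  shows "1 / (17 / 10 * real k) + 1 / 2 - 1 / (2 * real k) \<le> 659 / 1000 * (1 - log_gap k / (real k + 1))"
    and "k \<ge> 4 \<Longrightarrow> (real k - 1) / real k * (7 / 12) \<le> 659 / 1000 * (1 - log_gap k / (real k + 1))"
proof -
  have crude: "log_gap k \<le> (1 + 1 / real k) * ln (real k) + 4172 / 10000 - (1 - 1 / real k) * (2 * ln 2)"
  proof -
    have "2 * ln 2 + ln (real k) = ln (4 * real k)"
      using assms ln_realpow[of 2 2] by (simp add: ln_mult)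
    also have "\<dots> \<le> ln (4 * (real k + 1))" using assms by simp
    finally have "(1 - 1 / real k) * (2 * ln 2 + ln (real k)) \<le> (1 - 1 / real k) * ln (4 * (real k + 1))"
      using assms by (intro mult_left_mono) auto
    then show ?thesis unfolding log_gap_def using ln_85_69 by (simp add: algebra_simps)
  qed
  have tangent: "ln (real k) \<le> ln v + (real k - v) / v" if "v > 0" for v
  proof -
    have "ln (real k / v) \<le> real k / v - 1" using that assms by (intro ln_le_minus_one) simp
    then show ?thesis using that assms by (simp add: ln_div diff_divide_distrib)
  qed
  have k: "real k > 0" using assms by simp
  have eq1: "1 / (17 / 10 * real k) + 1 / 2 - 1 / (2 * real k) = 1 / 2 + 3 / 34 / real k"
    using k by (simp add: field_simps)
  have goal_iff: "v \<le> 659 / 1000 * (1 - log_gap k / (real k + 1)) \<longleftrightarrow>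
      log_gap k \<le> (1 - v * 1000 / 659) * (real k + 1)" for v
    by (simp add: field_simps)
  note ln2 = ln_2_bounds and ln3 = ln_3_bounds and ln5 = ln_5_bounds
  have ln4: "ln 4 = 2 * ln (2::real)" and ln16: "ln 16 = 4 * ln (2::real)"
    using ln_realpow[of 2 2] ln_realpow[of 2 4] by simp_all
  have ln20: "ln 20 = 2 * ln 2 + ln (5::real)"
    using ln_mult[of 4 "5::real"] ln4 by simp
  show main: "1 / (17 / 10 * real k) + 1 / 2 - 1 / (2 * real k) \<le> 659 / 1000 * (1 - log_gap k / (real k + 1))"
    unfolding eq1 goal_iff
  proof -
    \<comment> \<open>For \<open>k >= 5\<close> the tangent of \<open>ln\<close> at 5 makes the
      bound on \<open>log_gap\<close> linear in \<open>k\<close>; 3 and 4 are evaluated.\<close>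
    consider "k = 3" | "k = 4" | "k \<ge> 5" using assms by linarith
    then show "log_gap k \<le> (1 - (1 / 2 + 3 / 34 / real k) * 1000 / 659) * (real k + 1)"
    proof cases
      case 1
      then show ?thesis using ln_85_69 ln3 ln2 ln16 by (simp add: log_gap_def)
    next
      case 2
      have "log_gap (real k) = 2 * (2 * ln 2) + 2 * ln (85 / 69) - 3 / 4 * (2 * ln 2 + ln 5)"
        using 2 by (simp add: log_gap_def ln4 ln20)
      then have "log_gap (real k) \<le> 1" using ln_85_69 ln5 ln2 by (simp add: field_simps)
      also have "\<dots> \<le> (1 - (1 / 2 + 3 / 34 / real k) * 1000 / 659) * (real k + 1)"
        using 2 by simp
      finally show ?thesis .
    next
      case 3
      define z where "z = 1 / real k"
      have z: "0 < z" "z \<le> 1 / 5" "real k * z = 1" using 3 by (simp_all add: z_def field_simps)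
      have "log_gap k \<le> (1 + z) * ln (real k) + 4172 / 10000 - (1 - z) * (2 * ln 2)"
        using crude by (simp add: z_def)
      moreover have "(1 + z) * ln (real k) \<le> 6 / 5 * (ln 5 + (real k - 5) / 5)"
        using tangent[of 5] z 3 by (intro mult_mono) auto
      moreover have "4 / 5 * (2 * (6931 / 10000)) \<le> (1 - z) * (2 * ln 2)"
        using z ln2 by (intro mult_mono) auto
      moreover have "6 / 5 * (ln 5 + (real k - 5) / 5) = 6 / 5 * ln 5 + 6 / 25 * real k - 6 / 5"
        by (simp add: field_simps)
      ultimately have "log_gap k \<le> 6 / 5 * (160945 / 100000) + 6 / 25 * real k - 6 / 5 + 4172 / 10000 - 4 / 5 * (2 * (6931 / 10000))"
        using ln5 by linarith
      also have "\<dots> \<le> 159 / 659 * real k + 159 / 659 - 3000 / 22406 * (6 / 5)"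
        using 3 by simp
      also have "\<dots> \<le> 159 / 659 * real k + 159 / 659 - 3000 / 22406 * (1 + z)"
        using z by simp
      also have "\<dots> = (1 - (1 / 2 + 3 / 34 / real k) * 1000 / 659) * (real k + 1)"
        using k by (simp add: z_def field_simps)
      finally show ?thesis .
    qed
  qed
  show "(real k - 1) / real k * (7 / 12) \<le> 659 / 1000 * (1 - log_gap k / (real k + 1))" if "k \<ge> 4"
  proof (cases "k \<le> 8")
    \<comment> \<open>Up to 8 the left side is below that of the first claim: 7/12 - 1/2 is at most
      \<open>(7/12 + 3/34) / k\<close>.\<close>
    case True
    then have "(real k - 1) / real k * (7 / 12) \<le> 1 / 2 + 3 / 34 / real k"
      using k by (simp add: field_simps)
    then show ?thesis using main unfolding eq1 by linarith
  next
    case False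
    define z where "z = 1 / real k"
    have z: "0 < z" "z \<le> 1 / 9" "real k * z = 1" using False by (simp_all add: z_def field_simps)
    have "ln 12 = 2 * ln 2 + ln (3::real)" using ln_mult[of 4 "3::real"] ln4 by simp
    then have l12: "ln 12 \<le> (2485 / 1000::real)" using ln2 ln3 by simp
    have "log_gap k \<le> (1 + z) * ln (real k) + 4172 / 10000 - (1 - z) * (2 * ln 2)"
      using crude by (simp add: z_def)
    moreover have "(1 + z) * ln (real k) \<le> 10 / 9 * (ln 12 + (real k - 12) / 12)"
      using tangent[of 12] z False by (intro mult_mono) auto
    moreover have "8 / 9 * (2 * (6931 / 10000)) \<le> (1 - z) * (2 * ln 2)"
      using z ln2 by (intro mult_mono) auto
    moreover have "10 / 9 * (ln 12 + (real k - 12) / 12) = 10 / 9 * ln 12 + 5 / 54 * real k - 10 / 9"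
      by (simp add: field_simps)
    ultimately have "log_gap k \<le> 10 / 9 * (2485 / 1000) + 5 / 54 * real k - 10 / 9 + 4172 / 10000 - 8 / 9 * (2 * (6931 / 10000))"
      using l12 by linarith
    also have "\<dots> \<le> 227 / 1977 * real k + 1" by simp
    also have "\<dots> = (1 - 7 / 12 * 1000 / 659) * (real k + 1) + 7 / 12 * 1000 / 659"
      by (simp add: field_simps)
    also have "\<dots> \<le> (1 - (real k - 1) / real k * (7 / 12) * 1000 / 659) * (real k + 1)"
      using k by (simp add: field_simps)
    finally show ?thesis unfolding goal_iff .
  qed
qed

text \<open>Dividing \<open>k / (k - 1) * r + r\<^sup>2 / 2\<close> by \<open>k / (k - 1) * r\<^sup>2\<close> reduces the comparison with the target
  to an upper bound by this exponential.\<close>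
definition target_exp :: "real \<Rightarrow> real \<Rightarrow> real" where
  "target_exp k r = ((1 - 1 / k) * ln (4 * (k + 1)) + 2 * ln (69 / 50 / r)) / (k + 1)"

lemma target_exp_eq:
  assumes "k > 0" "r > 0"
  shows "target_exp k r = (2 * ln (17 / 10 * k / r) - log_gap k) / (k + 1)"
proof -
  have "ln (17 / 10 * k / r) = ln k + ln (17 / 10) - ln r"
    using assms ln_divide_pos[of "17 / 10 * k" r] ln_mult_pos[of "17 / 10" k] by simp
  moreover have "ln (69 / 50 / r) = ln (69 / 50) - ln r" using assms by (subst ln_div) auto
  moreover have "ln (85 / 69) = ln (17 / 10) - ln (69 / 50 :: real)"
    using ln_div[of "17 / 10" "69 / 50 :: real"] by simp
  ultimately show ?thesis unfolding target_exp_def log_gap_def by (simp add: algebra_simps)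
qed

text \<open>For \<open>k = 2\<close> the tangent of \<open>exp\<close> is too weak, already at
  \<open>r = 17/5\<close>. Cubing both sides removes the exponential and leaves a cubic inequality
  in \<open>r\<close>.\<close>

lemma long_target_2:
  fixes r :: real
  assumes "6 / 5 \<le> r" "r \<le> 17 / 5"
  shows "1 / r + 1 / 4 \<le> 6590 / 10000 * exp (target_exp 2 r)"
proof -
  \<comment> \<open>Between its endpoints \<open>r^2\<close> lies below its chord; used twice, this
    makes the cubic linear.\<close>
  have "(r - 6 / 5) * (r - 17 / 5) \<le> 0" using assms by (intro mult_nonneg_nonpos) auto
  moreover have "(r - 6 / 5) * (r - 17 / 5) = r ^ 2 - (23 / 5 * r - 102 / 25)"
    by (simp add: field_simps power2_eq_square)
  ultimately have r2: "r ^ 2 \<le> 23 / 5 * r - 102 / 25" by linarith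
  then have "r * r ^ 2 \<le> r * (23 / 5 * r - 102 / 25)" using assms by (intro mult_left_mono) auto
  then have r3: "r ^ 3 \<le> 23 / 5 * r ^ 2 - 102 / 25 * r" by (simp add: algebra_simps power2_eq_square power3_eq_cube)
  have "(4 + r) ^ 3 = 64 + 48 * r + 12 * r ^ 2 + r ^ 3" by (simp add: algebra_simps power2_eq_square power3_eq_cube)
  also have "\<dots> \<le> 1207 / 10 * r" using r2 r3 assms by simp
  finally have c1: "(4 + r) ^ 3 \<le> 1207 / 10 * r" .
  have r: "r > 0" using assms by simp
  have s12: "3464 / 1000 \<le> sqrt (12::real)" by (rule real_le_rsqrt) (simp add: power2_eq_square)
  have "exp (target_exp 2 r) ^ 3 = exp (3 * target_exp 2 r)" by (simp flip: exp_of_nat_mult)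
  also have "3 * target_exp 2 r = ln (sqrt 12) + ln ((69 / 50 / r) ^ 2)"
    using r by (simp add: target_exp_def ln_sqrt ln_realpow)
  also have "exp \<dots> = sqrt 12 * (69 / 50 / r) ^ 2" using r by (simp add: exp_add)
  finally have e3: "exp (target_exp 2 r) ^ 3 = sqrt 12 * (69 / 50 / r) ^ 2" .
  have "(1 / r + 1 / 4) ^ 3 = (4 + r) ^ 3 / (64 * r ^ 3)" using r by (simp add: field_simps power3_eq_cube)
  also have "\<dots> \<le> (1207 / 10 * r) / (64 * r ^ 3)" using c1 r by (intro divide_right_mono) auto
  also have "\<dots> = 1207 / 640 / r ^ 2" using r by (simp add: field_simps power2_eq_square power3_eq_cube)
  also have "\<dots> \<le> (659 / 1000) ^ 3 * (3464 / 1000) * (69 / 50) ^ 2 / r ^ 2"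
    by (intro divide_right_mono) (simp_all add: power2_eq_square power3_eq_cube)
  also have "\<dots> \<le> (659 / 1000) ^ 3 * sqrt 12 * (69 / 50) ^ 2 / r ^ 2"
    using s12 by (intro divide_right_mono mult_right_mono mult_left_mono) auto
  also have "\<dots> = (6590 / 10000 * exp (target_exp 2 r)) ^ 3"
    unfolding power_mult_distrib e3 by (simp add: power_divide)
  finally show ?thesis using r by (subst (asm) power_mono_iff) auto
qed

lemma two_powr_three_halves_le: "2 powr (1 + 1 / 2) \<le> (17 / 6 :: real)"
proof -
  have "sqrt 2 \<le> (17 / 12 :: real)" by (rule real_le_lsqrt) (simp_all add: power2_eq_square)
  then show ?thesis using powr_add[of 2 1 "1 / 2 :: real"] by (simp add: powr_half_sqrt)
qed

text \<open>With \<open>w = 17/10 * k / r\<close>, the bounds \<open>exp t >= 1 + t\<close> and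
  \<open>ln w >= 3/5 * (w - 1)\<close> make both sides linear in \<open>w\<close>. At
  \<open>w = 1\<close> the claim is \<open>log_gap_le\<close>, so only slopes remain to be
  compared.\<close>

lemma long_target:
  fixes k :: nat and r :: real
  assumes "2 \<le> k" "17 / 10 * real k \<le> r * 2 powr (1 + 1 / real k)" "r \<le> 17 / 10 * real k"
  shows "1 / r + (real k - 1) / (2 * real k) \<le> 659 / 1000 * exp (target_exp k r)"
proof -
  have r: "r > 0"
  proof (rule ccontr)
    assume "\<not> r > 0"
    then have "r * 2 powr (1 + 1 / real k) \<le> 0" by (intro mult_nonpos_nonneg) auto
    then show False using assms(1,2) by simp
  qed
  show ?thesis
  proof (cases "k = 2")
    case True
    have "17 / 5 \<le> r * 2 powr (1 + 1 / 2)" using assms(2) True by simp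
    also have "\<dots> \<le> r * (17 / 6)" using two_powr_three_halves_le r by (intro mult_left_mono) auto
    finally have "17 / 5 \<le> r * (17 / 6)" .
    then show ?thesis using long_target_2[of r] assms(3) True by simp
  next
    case False
    then have k: "3 \<le> k" using assms(1) by simp
    define w where "w = 17 / 10 * real k / r"
    have "2 powr (1 + 1 / real k) \<le> 2 powr (1 + 1 / 3 :: real)" using k by (intro powr_mono) (auto simp: field_simps)
    also have "\<dots> \<le> 63 / 25"
    proof -
      have "(2 powr (1 + 1 / 3 :: real)) ^ 3 = 2 powr 4"
        by (simp add: powr_powr powr_realpow[symmetric] del: powr_numeral)
      also have "\<dots> \<le> (63 / 25) ^ 3" by (simp add: power3_eq_cube)
      finally show ?thesis by (subst (asm) power_mono_iff) auto
    qed
    finally have "r * 2 powr (1 + 1 / real k) \<le> r * (63 / 25)" using r by (intro mult_left_mono) auto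
    then have "17 / 10 * real k \<le> r * (63 / 25)" using assms(2) by linarith
    then have w: "1 \<le> w" "w \<le> 63 / 25" using assms(2,3) r by (simp_all add: w_def field_simps)
    have wr: "1 / r = w / (17 / 10 * real k)" using r k by (simp add: w_def)
    have "w / (17 / 10 * real k) + (real k - 1) / (2 * real k)
      = (1 / (17 / 10 * real k) + 1 / 2 - 1 / (2 * real k)) + (w - 1) / (17 / 10 * real k)"
      using k by (simp add: field_simps)
    also have "\<dots> \<le> 659 / 1000 * (1 - log_gap k / (real k + 1)) + (w - 1) / (17 / 10 * real k)"
      using log_gap_le(1)[OF k] by simp
    \<comment> \<open>The slopes compare if \<open>(k + 1) / k\<close> is at most 1.7 * 0.659 * 1.2,
      about 1.344; this is where \<open>k >= 3\<close> enters.\<close>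
    also have "(w - 1) / (17 / 10 * real k) \<le> 659 / 1000 * (2 * (3 / 5 * (w - 1)) / (real k + 1))"
    proof -
      have "(w - 1) * (1 / (17 / 10 * real k)) \<le> (w - 1) * (659 / 1000 * (6 / 5) / (real k + 1))"
        using w k by (intro mult_left_mono) (simp_all add: field_simps)
      also have "\<dots> = 659 / 1000 * (2 * (3 / 5 * (w - 1)) / (real k + 1))" by (simp add: field_simps)
      finally show ?thesis by simp
    qed
    also have "\<dots> \<le> 659 / 1000 * (2 * ln w / (real k + 1))"
      using ln_ge_secant[OF w] by (intro mult_left_mono divide_right_mono) auto
    also have "659 / 1000 * (1 - log_gap k / (real k + 1)) + 659 / 1000 * (2 * ln w / (real k + 1))
      = 659 / 1000 * (1 + target_exp k r)"
    proof -
      have "target_exp k r = 2 * ln w / (real k + 1) - log_gap k / (real k + 1)"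
        using r k by (simp only: target_exp_eq w_def diff_divide_distrib of_nat_0_less_iff)
      moreover have distrib: "u * (1 - v) + u * y = u * (1 + (y - v))" for u v y :: real
        by (simp add: algebra_simps)
      ultimately show ?thesis by (simp only: distrib)
    qed
    also have "\<dots> \<le> 659 / 1000 * exp (target_exp k r)" by (intro mult_left_mono exp_ge_add_one_self) auto
    finally show ?thesis unfolding wr by simp
  qed
qed

text \<open>This serves \<open>q = 1\<close>. The two bounds on \<open>r\<close> force
  \<open>k >= 4\<close>, and \<open>r <= 17/10 * k\<close> makes the term with
  \<open>ln (17/10 * k / r)\<close> nonnegative.\<close>

lemma short_target:
  fixes k :: nat and r :: real
  assumes "2 \<le> k" "6 \<le> r" "r \<le> 17 / 10 * real k"
  shows "(real k - 1) / real k * ((1 + 1 / r) / 2) \<le> 659 / 1000 * exp (target_exp k r)"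
proof -
  have k: "4 \<le> k" using assms(2,3) by linarith
  have "(real k - 1) / real k * ((1 + 1 / r) / 2) \<le> (real k - 1) / real k * (7 / 12)"
    using assms k by (intro mult_left_mono) (auto simp: field_simps)
  also have "\<dots> \<le> 659 / 1000 * (1 - log_gap k / (real k + 1))"
    using k by (intro log_gap_le) auto
  also have "\<dots> \<le> 659 / 1000 * (1 + target_exp k r)"
  proof -
    have "0 \<le> ln (17 / 10 * real k / r)" using assms by (intro ln_ge_zero) (auto simp: field_simps)
    then have "0 \<le> 2 * ln (17 / 10 * real k / r) / (real k + 1)" by simp
    moreover have "target_exp k r = 2 * ln (17 / 10 * real k / r) / (real k + 1) - log_gap k / (real k + 1)"
      using assms by (simp only: target_exp_eq diff_divide_distrib)
    ultimately show ?thesis by simp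
  qed
  also have "\<dots> \<le> 659 / 1000 * exp (target_exp k r)" by (intro mult_left_mono exp_ge_add_one_self) auto
  finally show ?thesis .
qed


text \<open>Raising \<open>rq\<close> to the power \<open>2 * K / (K + 1)\<close> produces exactly
  the factor of the target that depends on \<open>x\<close>, and turns
  \<open>q powr (1 + 1 / K)\<close> into \<open>q^2\<close>. Thus \<open>x\<close> is eliminated in
  favour of \<open>q\<close> and \<open>r\<close>.\<close>

lemma target_eq:
  fixes K q r x :: real
  assumes K: "K > 1" and q: "q > 0" and r: "r > 0" and x: "x > 1"
    and rq: "69 / 50 * (K + 1) * x powr (1 / K) / ln x = r * q powr (1 + 1 / K)"
  shows "K\<^sup>2 / (K - 1) * (K + 1) powr ((K - 1) / K) * (x powr (2 / (K + 1)) / ln x powr (2 * K / (K + 1)))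
      * (4 powr ((K - 1) / (K * (K + 1))) * ((K + 1) / K))
    = q\<^sup>2 * (K / (K - 1)) * (r\<^sup>2 / (69 / 50)\<^sup>2 * exp (target_exp K r))"
proof -
  define b where "b = r / (69 / 50)"
  define e where "e = 2 * K / (K + 1)"
  have b: "b > 0" using r by (simp add: b_def)
  have "69 / 50 * (K + 1) * (x powr (1 / K) / ln x) = r * q powr (1 + 1 / K)"
    using rq by simp
  moreover have "y = r / (69 / 50) / (K + 1) * v" if "69 / 50 * (K + 1) * y = r * v" for y v
  proof -
    have "y = 69 / 50 * (K + 1) * y / (69 / 50 * (K + 1))" using K by simp
    then show ?thesis unfolding that by simp
  qed
  ultimately have "x powr (1 / K) / ln x = b / (K + 1) * q powr (1 + 1 / K)"
    unfolding b_def by blast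
  then have "(x powr (1 / K) / ln x) powr e = (b / (K + 1) * q powr (1 + 1 / K)) powr e" by simp
  moreover have "(x powr (1 / K) / ln x) powr e = x powr (2 / (K + 1)) / ln x powr e"
    using x K by (simp add: powr_divide powr_powr e_def)
  moreover have "(b / (K + 1) * q powr (1 + 1 / K)) powr e = (b / (K + 1)) powr e * q powr ((1 + 1 / K) * e)"
    using powr_mult[of "b / (K + 1)" "q powr (1 + 1 / K)" e] b K q by (simp only: powr_powr)
  moreover have "(1 + 1 / K) * e = 2"
  proof -
    have "1 + 1 / K = (K + 1) / K" using K by (simp add: field_simps)
    then show ?thesis using K by (simp add: e_def divide_eq_eq)
  qed
  ultimately have pw: "x powr (2 / (K + 1)) / ln x powr (2 * K / (K + 1)) = (b / (K + 1)) powr e * q\<^sup>2"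
    using q by (simp add: e_def)
  have expo: "(K - 1) / K * ln (K + 1) + (e * (ln b - ln (K + 1)) + ((K - 1) / (K * (K + 1)) * ln 4 + ln (K + 1)))
     = 2 * ln b + target_exp K r"
  proof -
    have l1: "ln (4 * (K + 1)) = ln 4 + ln (K + 1)" using K by (intro ln_mult_pos) auto
    have l2: "ln (69 / 50 / r) = - ln b"
      using r ln_divide_pos[of "69 / 50" r] ln_divide_pos[of r "69 / 50"] unfolding b_def by simp
    show ?thesis unfolding target_exp_def l1 l2 e_def using K by (simp add: divide_simps) (simp add: algebra_simps)
  qed
  have "(K + 1) powr ((K - 1) / K) * ((b / (K + 1)) powr e * (4 powr ((K - 1) / (K * (K + 1))) * (K + 1)))
     = exp ((K - 1) / K * ln (K + 1) + (e * (ln b - ln (K + 1)) + ((K - 1) / (K * (K + 1)) * ln 4 + ln (K + 1))))"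
    using K b by (simp only: exp_add powr_def ln_divide_pos) (simp add: ln_divide_pos)
  also have "\<dots> = b\<^sup>2 * exp (target_exp K r)"
    unfolding expo exp_add using b by (simp add: exp_double)
  finally have main: "(K + 1) powr ((K - 1) / K) * ((b / (K + 1)) powr e * (4 powr ((K - 1) / (K * (K + 1))) * (K + 1)))
     = b\<^sup>2 * exp (target_exp K r)" .
  have "K\<^sup>2 / (K - 1) * (K + 1) powr ((K - 1) / K) * ((b / (K + 1)) powr e * q\<^sup>2)
      * (4 powr ((K - 1) / (K * (K + 1))) * ((K + 1) / K))
    = q\<^sup>2 * (K / (K - 1)) *
      ((K + 1) powr ((K - 1) / K) * ((b / (K + 1)) powr e * (4 powr ((K - 1) / (K * (K + 1))) * (K + 1))))"
    using K by (simp add: field_simps power2_eq_square)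
  then show ?thesis unfolding pw main by (simp add: b_def power_divide)
qed

theorem theorem2p1:
  fixes k M0 M :: nat and x :: real
  assumes "k > 1" and "x > 0" and "M0 \<ge> 6"
    and "(\<Sum>t=1..M. real (p t) ^ k) \<le> x"
    and "x < (\<Sum>t=1..M+1. real (p t) ^ k)"
    and "M \<ge> M0"
  shows "real (s k x) \<le> c k * (x powr (2 / (real k + 1)) / (ln x) powr (2 * real k / (real k + 1))) * U (real M0) k"
proof -
  define K where "K = real k"
  \<comment> \<open>\<open>b * m powr (-1 / K)\<close> is the bound of
    \<open>card_starts_le\<close>.\<close>
  define b where "b = 69 / 50 * (K + 1) * x powr (1 / K) / ln x"
  have K: "K \<ge> 2" using assms(1) by (simp add: K_def)
  have px: "real (p t) ^ k \<le> x" if "t \<in> {1..M}" for t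
    using member_le_sum[of t "{1..M}" "\<lambda>t. real (p t) ^ k"] that assms(4) by simp
  \<comment> \<open>The size of \<open>M\<close> enters here and in the case \<open>q = 1\<close>;
    the crude \<open>p 6 >= 7\<close> is enough.\<close>
  have x7: "7 ^ k \<le> x"
  proof -
    have "(7::real) ^ k \<le> real (p 6) ^ k" using p_ge[of 6] by (intro power_mono) auto
    also have "\<dots> \<le> x" using assms(3,6) by (intro px) auto
    finally show ?thesis .
  qed
  have xg: "x \<ge> 7" using x7 assms(1) self_le_power[of "7::real" k] by simp
  have l7: "194 / 100 \<le> ln (7::real)" using ln_approx_bounds[of 7 8] by (simp add: eval_nat_numeral)
  have lx: "194 / 100 * K \<le> ln x"
  proof -
    have "K * ln 7 = ln (7 ^ k)" by (simp add: ln_realpow K_def)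
    also have "\<dots> \<le> ln x" using x7 by (intro ln_mono) auto
    finally have "K * ln 7 \<le> ln x" .
    moreover have "K * (194 / 100) \<le> K * ln 7" using l7 K by (intro mult_left_mono) auto
    ultimately show ?thesis by linarith
  qed
  have lx0: "ln x > 0" using xg by simp
  have b0: "b > 0" unfolding b_def using K lx0 xg by simp
  define e where "e = 1 + 1 / K"
  have e: "e > 1" using K by (simp add: e_def)
  \<comment> \<open>The condition says \<open>b / q powr e <= 17/10 * K\<close>. With 17/10 the
    resulting window for this ratio, from \<open>17/10 * K / 2 powr e\<close> to
    \<open>17/10 * K\<close>, contains the optimum \<open>K\<close>.\<close>
  define ok where "ok q \<longleftrightarrow> 1 \<le> q \<and> b \<le> 17 / 10 * K * real q powr e" for q
  define q where "q = (LEAST q. ok q)"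
  have "ok (nat \<lceil>b\<rceil>)"
  proof -
    have n: "real (nat \<lceil>b\<rceil>) \<ge> b" "nat \<lceil>b\<rceil> \<ge> 1" using b0 by linarith+
    have "1 * real (nat \<lceil>b\<rceil>) powr 1 \<le> 17 / 10 * K * real (nat \<lceil>b\<rceil>) powr e"
      using n e K by (intro mult_mono powr_mono) auto
    then show ?thesis unfolding ok_def using n by simp
  qed
  then have "ok q" unfolding q_def by (rule LeastI)
  then have q1: "1 \<le> q" and bq: "b \<le> 17 / 10 * K * real q powr e" by (auto simp: ok_def)
  define r where "r = b / real q powr e"
  have qe: "real q powr e > 0" using q1 by simp
  have r0: "r > 0" unfolding r_def using b0 qe by simp
  have b_eq: "b = r * real q powr e" unfolding r_def using qe by simp
  have r_le: "r \<le> 17 / 10 * K" using bq qe unfolding r_def by (simp add: divide_le_eq)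
  \<comment> \<open>By minimality \<open>q - 1\<close> fails the condition, and
    \<open>q - 1 >= q / 2\<close> costs the factor \<open>2 powr e\<close>.\<close>
  have r_ge: "17 / 10 * K \<le> r * 2 powr e" if "q \<ge> 2"
  proof -
    have "\<not> ok (q - 1)" using not_less_Least[of "q - 1" ok] that unfolding q_def by simp
    moreover have "1 \<le> q - 1" using that by simp
    ultimately have "17 / 10 * K * real (q - 1) powr e \<le> b" unfolding ok_def by linarith
    moreover have "real q / 2 \<le> real (q - 1)" using that by simp
    then have "17 / 10 * K * (real q / 2) powr e \<le> 17 / 10 * K * real (q - 1) powr e"
      using e K by (intro mult_left_mono powr_mono2) auto
    ultimately have "17 / 10 * K * (real q / 2) powr e \<le> r * real q powr e" using b_eq by linarith
    then have "17 / 10 * K * real q powr e \<le> (r * 2 powr e) * real q powr e"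
      using q1 by (simp add: powr_divide field_simps)
    then show ?thesis using qe by (simp only: mult_le_cancel_right_pos)
  qed
  \<comment> \<open>This admits all lengths up to \<open>q\<close> to \<open>card_starts_le\<close>.
    It amounts to \<open>1.38 * (K + 1) <= r * ln x\<close>, which follows from
    \<open>r >= 0.6 * K\<close> and \<open>ln x >= 1.94 * K\<close>.\<close>
  have qx: "real q ^ (k + 1) \<le> x"
  proof (cases "q = 1")
    case True
    then show ?thesis using xg by simp
  next
    case False
    have "2 powr e \<le> 2 powr (1 + 1 / 2 :: real)" using K unfolding e_def by (intro powr_mono) (auto simp: field_simps)
    also have "\<dots> \<le> 17 / 6" by (rule two_powr_three_halves_le)
    finally have "r * 2 powr e \<le> r * (17 / 6)" using r0 by (intro mult_left_mono) auto
    then have "3 / 5 * K \<le> r" using r_ge False q1 by simp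
    then have "3 / 5 * K * (194 / 100 * K) \<le> r * ln x" using lx K r0 by (intro mult_mono) auto
    moreover have "69 / 50 * (K + 1) \<le> 3 / 5 * K * (194 / 100 * K)"
    proof -
      have "K * 2 \<le> K * K" using K by (intro mult_left_mono) auto
      moreover have "3 / 5 * K * (194 / 100 * K) = 1164 / 1000 * (K * K)" by simp
      moreover have "69 / 50 * (K + 1) = 69 / 50 * K + 69 / 50" by (simp add: algebra_simps)
      ultimately show ?thesis using K by linarith
    qed
    ultimately have "69 / 50 * (K + 1) \<le> r * ln x" by linarith
    then have "69 / 50 * (K + 1) * x powr (1 / K) \<le> r * ln x * x powr (1 / K)"
      by (intro mult_right_mono) auto
    then have "b \<le> r * x powr (1 / K)" unfolding b_def using lx0 by (simp add: divide_le_eq mult_ac)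
    then have "real q powr e \<le> x powr (1 / K)" unfolding b_eq using r0 by simp
    then have "(real q powr e) powr K \<le> (x powr (1 / K)) powr K" using K by (intro powr_mono2) auto
    moreover have "e * K = real (k + 1)" using K by (simp add: e_def K_def field_simps)
    then have "(real q powr e) powr K = real q ^ (k + 1)"
      using q1 by (simp only: powr_powr powr_realpow of_nat_0_less_iff Suc_le_eq One_nat_def)
    moreover have "(x powr (1 / K)) powr K = x" using K xg by (simp add: powr_powr)
    ultimately show ?thesis by simp
  qed
  have starts: "real (card (starts k x m)) \<le> b * real m powr (- 1 / K)" if "m \<in> {1..q}" for m
  proof -
    have "real m ^ (k + 1) \<le> real q ^ (k + 1)" using that by (intro power_mono) auto
    then show ?thesis unfolding b_def K_def using that assms(1) qx x7 by (intro card_starts_le) auto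
  qed
  have r_starts: "b * real q powr (- 1 / K) = r * real q"
  proof -
    have "real q powr e * real q powr (- 1 / K) = real q powr 1"
      unfolding powr_add[symmetric] by (simp add: e_def)
    then show ?thesis unfolding b_eq using q1 by (simp add: mult.assoc)
  qed
  define Pq where "Pq = real (card (starts k x q))"
  have Pq: "0 \<le> Pq" "Pq \<le> r * real q"
    using starts[of q] q1 r_starts unfolding Pq_def by auto
  have s1: "real (s k x) \<le> (\<Sum>m=1..q. real (card (starts k x m))) + Pq * (Pq - 1) / 2"
    unfolding Pq_def using assms(1) q1 by (intro s_le) auto
  define T where "T = 659 / 1000 * exp (target_exp K r)"
  have key: "real (s k x) \<le> real q ^ 2 * (K / (K - 1)) * (r ^ 2 * T)"
  proof (cases "q = 1")
    case True
    have "6 \<le> card (starts k x 1)"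
    proof -
      have "{1..6} \<subseteq> starts k x 1" using px assms(3,6) by (auto simp: starts_def)
      then have "card {1..6::nat} \<le> card (starts k x 1)"
        using finite_starts[of k 1 x] assms(1) by (intro card_mono) auto
      then show ?thesis by simp
    qed
    then have r6: "6 \<le> r" using Pq(2) True by (simp add: Pq_def)
    have t: "(K - 1) / K * ((1 + 1 / r) / 2) \<le> T"
      unfolding T_def K_def using r6 r_le assms(1) by (intro short_target) (auto simp: K_def)
    \<comment> \<open>The sum is the single term \<open>P 1\<close>, so the factor
      \<open>K / (K - 1)\<close> of \<open>sum_powr_le\<close> is avoided, and the -1 of the
      binomial coefficient is kept.\<close>
    have "real (s k x) \<le> Pq + Pq * (Pq - 1) / 2" using s1 True by (simp add: Pq_def)
    also have "\<dots> = Pq * (Pq + 1) / 2" by (simp add: field_simps)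
    also have "\<dots> \<le> r * (r + 1) / 2" using Pq True by (intro divide_right_mono mult_mono) auto
    also have "\<dots> = K / (K - 1) * (r ^ 2 * ((K - 1) / K * ((1 + 1 / r) / 2)))"
      using K r0 by (simp add: field_simps power2_eq_square)
    also have "\<dots> \<le> K / (K - 1) * (r ^ 2 * T)" using t K by (intro mult_left_mono) auto
    finally show ?thesis using True by simp
  next
    case False
    then have q2: "q \<ge> 2" using q1 by simp
    have t: "1 / r + (K - 1) / (2 * K) \<le> T"
      unfolding T_def K_def using r_ge[OF q2] r_le assms(1) by (intro long_target) (auto simp: K_def e_def)
    have K1: "1 - 1 / K = (K - 1) / K" using K by (simp add: field_simps)
    have "(\<Sum>m=1..q. real (card (starts k x m))) \<le> (\<Sum>m=1..q. b * real m powr ((1 - 1 / K) - 1))"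
      using starts by (intro sum_mono) simp
    also have "\<dots> = b * (\<Sum>m=1..q. real m powr ((1 - 1 / K) - 1))" by (simp add: sum_distrib_left)
    also have "\<dots> \<le> b * (real q powr (1 - 1 / K) / (1 - 1 / K))"
      using K b0 by (intro mult_left_mono sum_powr_le) auto
    also have "\<dots> = K / (K - 1) * (r * (real q powr e * real q powr (1 - 1 / K)))"
      unfolding K1 b_eq by simp
    also have "real q powr e * real q powr (1 - 1 / K) = real q ^ 2"
      unfolding powr_add[symmetric] using q1 by (simp add: e_def)
    finally have a1: "(\<Sum>m=1..q. real (card (starts k x m))) \<le> K / (K - 1) * (r * real q ^ 2)" .
    have "Pq * (Pq - 1) \<le> Pq * Pq" using Pq by (intro mult_left_mono) auto
    also have "\<dots> \<le> (r * real q) * (r * real q)" using Pq by (intro mult_mono) auto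
    also have "\<dots> = r ^ 2 * real q ^ 2" by (simp add: power2_eq_square mult_ac)
    finally have a2: "Pq * (Pq - 1) / 2 \<le> r ^ 2 * real q ^ 2 / 2" by (rule divide_right_mono) simp
    have "real (s k x) \<le> K / (K - 1) * (r * real q ^ 2) + r ^ 2 * real q ^ 2 / 2"
      using s1 a1 a2 by linarith
    also have "\<dots> = real q ^ 2 * (K / (K - 1)) * (r ^ 2 * (1 / r + (K - 1) / (2 * K)))"
      using K r0 by (simp add: field_simps power2_eq_square)
    also have "\<dots> \<le> real q ^ 2 * (K / (K - 1)) * (r ^ 2 * T)"
      using t K by (intro mult_left_mono) auto
    finally show ?thesis .
  qed
  define V where "V = real q ^ 2 * (K / (K - 1)) * r ^ 2 * exp (target_exp K r)"
  have V0: "V \<ge> 0" using K unfolding V_def by simp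
  define X where "X = x powr (2 / (K + 1)) / ln x powr (2 * K / (K + 1))"
  define W where "W = 4 powr ((K - 1) / (K * (K + 1))) * ((K + 1) / K)"
  have "real (s k x) \<le> 659 / 1000 * V" using key by (simp add: T_def V_def mult_ac)
  \<comment> \<open>0.659 is \<open>1.25506 / 1.38^2\<close> rounded down.\<close>
  also have "\<dots> \<le> 1.25506 / (69 / 50)\<^sup>2 * V" using V0 by (intro mult_right_mono) (auto simp: power2_eq_square)
  also have "\<dots> = 1.25506 * (real q ^ 2 * (K / (K - 1)) * (r\<^sup>2 / (69 / 50)\<^sup>2 * exp (target_exp K r)))"
    by (simp add: V_def mult_ac)
  also have "\<dots> = 1.25506 * (K\<^sup>2 / (K - 1) * (K + 1) powr ((K - 1) / K) * X * W)"
    unfolding X_def W_def using K q1 r0 xg b_eq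
    by (subst target_eq[of K "real q" r x]) (auto simp: b_def e_def)
  also have "\<dots> = c k * X * (1.25506 * W)" unfolding c_def K_def by (simp only: mult_ac)
  also have "\<dots> \<le> c k * X * U (real M0) k"
  proof (rule mult_left_mono)
    show "1.25506 * W \<le> U (real M0) k"
      using U_ge[of k "real M0"] assms(1,3) unfolding W_def K_def by (simp add: mult.assoc)
    show "0 \<le> c k * X" using K unfolding c_def X_def K_def by simp
  qed
  finally show ?thesis unfolding X_def K_def .
qed

end
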